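(* For each integer $m\ge1$ let $\gamma_H^{(m)}$ be the limit eigenvalue distribution of random block Hankel matrices with $m\times m$ blocks, as defined in the context. As $m\to\infty$, $\gamma_H^{(m)}$ converges weakly to the semicircle law, i.e. to the probability distribution on $\mathbb R$ with density $w(x)=\frac1{2\pi}\sqrt{4-x^2}$ for $|x|\le2$ and $w(x)=0$ for $|x|>2$.
   Context: Definition of $\gamma_H^{(m)}$. $\gamma_H^{(m)}$ is the probability distribution on $\mathbb R$ with vanishing odd moments determined by its even moments, for integers $k\ge1$, $$m_{2k}(\gamma_H^{(m)})=\int x^{2k}\,d\gamma_H^{(m)}=\sum_{\pi\in\mathcal P_2^1(2k)}\frac{r(m,\pi)}{m^{k+1}}\int_{[0,1]\times[-1,1]^k}\prod_{j=1}^{2k}I_{[0,1]}\Big(x_0-\sum_{q=1}^{j}(-1)^q\,x_{\pi(q)}\Big)\prod_{l=0}^{k}\mathrm d x_l .$$ It is the almost sure weak limit, as $N\to\infty$, of the empirical eigenvalue distribution of $H_N/\sqrt{mN}$, where $H_N=(A_{N+1-i-j})_{i,j=1}^N$ is the $mN\times mN$ block matrix with $(i,j)$ block $A_{N+1-i-j}$, $A_s=(a_{ij}(s))_{i,j=1}^m$ real random $m\times m$ matrices ($-(N-1)\le s\le N-1$) with $A_s=(A_s)^T$, entries independent apart from this symmetry, $E(a_{ij}(s))=0$, $E(|a_{ij}(s)|^2)=1$, and for every $k$, $\sup E|a_{ij}(s)|^k<\infty$ (supremum over all $i,j,s$, $N$ and $m$). Notation. $\mathcal P_2^1(2k)$ is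 the set of partitions $\pi=\{V_1,\dots,V_k\}$ of $\{1,\dots,2k\}$ into two-element blocks each of which contains exactly one even element and exactly one odd element; the blocks are labelled and $\pi(q)=i$ means $q\in V_i$. For $\pi=\{\{a_1,b_1\},\dots,\{a_k,b_k\}\}$, $r(m,\pi)$ is the number of $(t_1,\dots,t_{2k})\in\{1,\dots,m\}^{2k}$ such that (with $t_{2k+1}=t_1$) for every $1\le i\le k$ either $t_{a_i}=t_{b_i}$ and $t_{a_i+1}=t_{b_i+1}$, or $t_{a_i}=t_{b_i+1}$ and $t_{a_i+1}=t_{b_i}$. $I_{[0,1]}$ is the indicator function of $[0,1]$. *)

theory Defs
  imports "HOL-Probability.Probability"
begin

definition odd_even_pairings :: "nat \<Rightarrow> nat set set set" where
  "odd_even_pairings k =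
     {\<pi>. partition_on {1..2*k} \<pi> \<and>
          (\<forall>V\<in>\<pi>. card V = 2 \<and> card {v\<in>V. even v} = 1 \<and> card {v\<in>V. odd v} = 1)}"

text \<open>
  A partition carries no labelling of its blocks, so one is fixed here: the blocks are numbered
  \<open>1, \<dots>, k\<close> by increasing minimum, and \<open>block_label \<pi> q\<close> is the number of the block
  containing \<open>q\<close>. Relabelling only permutes the variables \<open>x\<^sub>1, \<dots>, x\<^sub>k\<close>, which all range over
  the same interval, so \<open>hankel_volume\<close> does not depend on this choice.
\<close>

definition block_label :: "nat set set \<Rightarrow> nat \<Rightarrow> nat" where
  "block_label \<pi> q = card {V\<in>\<pi>. Min V \<le> Min (THE W. W \<in> \<pi> \<and> q \<in> W)}"

definition hankel_volume :: "nat \<Rightarrow> nat set set \<Rightarrow> real" where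
  "hankel_volume k \<pi> =
     (LINT x : (\<Pi>\<^sub>E l\<in>{0..k}. if l = 0 then {0..1} else {-1..1::real}) | (\<Pi>\<^sub>M l\<in>{0..k}. lborel).
        (\<Prod>j=1..2*k. indicat_real {0..1} (x 0 - (\<Sum>q=1..j. (-1)^q * x (block_label \<pi> q)))))"

text \<open>The successor in the cyclic order of \<open>1, \<dots>, 2k\<close>, implementing \<open>t\<^bsub>2k+1\<^esub> = t\<^sub>1\<close>.\<close>

definition cyclic_next :: "nat \<Rightarrow> nat \<Rightarrow> nat" where
  "cyclic_next k a = (if a = 2*k then 1 else a + 1)"

definition r_count :: "nat \<Rightarrow> nat \<Rightarrow> nat set set \<Rightarrow> nat" where
  "r_count m k \<pi> = card {t \<in> {1..2*k} \<rightarrow>\<^sub>E {1..m}.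
     \<forall>a b. {a, b} \<in> \<pi> \<longrightarrow>
       (t a = t b \<and> t (cyclic_next k a) = t (cyclic_next k b)) \<or>
       (t a = t (cyclic_next k b) \<and> t (cyclic_next k a) = t b)}"

definition block_hankel_moment :: "nat \<Rightarrow> nat \<Rightarrow> real" where
  "block_hankel_moment m k =
     (\<Sum>\<pi>\<in>odd_even_pairings k. real (r_count m k \<pi>) / real m ^ (k + 1) * hankel_volume k \<pi>)"

text \<open>
  Integrability is required separately because the Bochner integral of a non-integrable
  function is \<open>0\<close>.
\<close>

definition is_gamma_H :: "nat \<Rightarrow> real measure \<Rightarrow> bool" where
  "is_gamma_H m \<mu> \<longleftrightarrow>
     real_distribution \<mu> \<and>
     (\<forall>n. integrable \<mu> (\<lambda>x. x ^ n)) \<and>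
     (\<forall>n. odd n \<longrightarrow> (LINT x|\<mu>. x ^ n) = 0) \<and>
     (\<forall>k\<ge>1. (LINT x|\<mu>. x ^ (2*k)) = block_hankel_moment m k)"

definition semicircle_density :: "real \<Rightarrow> real" where
  "semicircle_density x = (if \<bar>x\<bar> \<le> 2 then 1 / (2 * pi) * sqrt (4 - x\<^sup>2) else 0)"

definition semicircle_law :: "real measure" where
  "semicircle_law = density lborel (\<lambda>x. ennreal (semicircle_density x))"

end

theory Submission
  imports Defs
begin

text \<open>
  The proof is the method of moments. Odd moments vanish on both sides, so the task is to show that
  for every \<open>k \<ge> 1\<close> the moment of order \<open>2 k\<close> tends to the \<open>k\<close>-th Catalan number, which is the
  corresponding moment of the semicircle law. Since these limits are at most \<open>4 ^ k\<close>, the Taylor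
  expansions of the characteristic functions converge and Levy's continuity theorem applies
  (\<open>weak_conv_m_of_moments\<close>).

  The moment of order \<open>2 k\<close> is a finite sum over pairings \<open>\<pi>\<close>, so each summand may be studied
  separately as \<open>m\<close> grows. A tuple counted by \<open>r_count\<close> is a closed walk \<open>t\<close> of length \<open>2 k\<close>
  whose two edges in a block of \<open>\<pi>\<close> have the same end points, traversed in the same or in opposite
  directions. Hence the increments of the walk agree up to sign within a block, and \<open>t\<close> is determined
  by its starting point, the signs and one increment for each block: there are
  \<open>O(m ^ (k + 1))\<close> such walks. One more factor \<open>m\<close> is lost as soon as the walk has a closed
  piece which uses an edge of some block exactly once, because the increments along that piece sum to
  zero and so determine the increment of this block (\<open>card_labelings_closed_subwalk\<close>). If a block is
  traversed twice in the same direction, the piece from its first edge up to its second one is of this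
  kind; if it is traversed in opposite directions and is crossed by another block, so is the piece
  strictly between its two edges. Therefore crossing pairings contribute nothing in the limit
  (\<open>r_count_crossing\<close>), and for a noncrossing pairing only the walks that reverse every block matter.
  Those are walks around a plane tree with \<open>k\<close> edges, and there are exactly \<open>m ^ (k + 1)\<close> of them,
  one for every labelling of the vertices of the tree (\<open>card_reversed_labelings\<close>).

  The same tree makes the volume of a noncrossing pairing equal to \<open>1\<close>: the sums in the indicator
  functions are the values of a walk around the tree, so passing from the variables to the values at
  the vertices is a unimodular triangular change of coordinates which turns the integrand into the
  indicator function of the unit cube (\<open>nn_integral_tree_indicator\<close>, \<open>hankel_volume_noncrossing\<close>).
  The limit of the moment is thus the number of noncrossing pairings. Splitting a pairing at the
  partner of the first element gives the Catalan convolution (\<open>card_nc_pairings\<close>); a generating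
  function turns this into a first order recursion (\<open>catalan_linear_rec\<close>), which integration by
  parts also yields for the moments of the semicircle law (\<open>semicircle_moment_Suc_Suc\<close>).
\<close>

section \<open>Weak convergence from convergence of moments\<close>

text \<open>
  The Taylor remainder of order \<open>2 K\<close> of a characteristic function at \<open>t\<close> is controlled by the
  moment of order \<open>2 K\<close>. Its limit is at most \<open>2 (\<bar>t\<bar> R) ^ (2 K) / fact (2 K)\<close>, which is arbitrarily
  small for large \<open>K\<close>; for fixed \<open>K\<close> the Taylor polynomials converge because the moments do.
\<close>

lemma weak_conv_m_of_moments:
  fixes M :: "nat \<Rightarrow> real measure" and N :: "real measure" and R :: real
  assumes M: "\<And>n. real_distribution (M n)" and N: "real_distribution N"
    and intM: "\<And>n j. integrable (M n) (\<lambda>x. x ^ j)" and intN: "\<And>j. integrable N (\<lambda>x. x ^ j)"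
    and conv: "\<And>j. (\<lambda>n. LINT x|M n. x ^ j) \<longlonglongrightarrow> (LINT x|N. x ^ j)"
    and bound: "\<And>j. (LINT x|N. x ^ (2 * j)) \<le> R ^ (2 * j)"
  shows "weak_conv_m M N"
proof (rule levy_continuity[OF M N])
  fix t :: real
  define S where "S K \<mu> = (\<Sum>j\<le>2*K. ((\<i> * t) ^ j / fact j) * (LINT x|\<mu>. x ^ j))" for K and \<mu> :: "real measure"
  define T where "T K \<mu> = (2 * \<bar>t\<bar> ^ (2*K) / fact (2*K)) * (LINT x|\<mu>. x ^ (2*K))" for K and \<mu> :: "real measure"
  have taylor: "cmod (char \<mu> t - S K \<mu>) \<le> T K \<mu>"
    if "real_distribution \<mu>" "\<And>j. integrable \<mu> (\<lambda>x. x ^ j)" for \<mu> K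
    using real_distribution.char_approx1[OF that(1), of "2*K" t] that(2)
    by (simp add: S_def T_def power_even_abs)
  show "(\<lambda>n. char (M n) t) \<longlonglongrightarrow> char N t"
  proof (rule metric_LIMSEQ_I)
    fix e :: real assume e: "e > 0"
    have "(\<lambda>n. inverse (fact n) * (\<bar>t\<bar> * R) ^ n) \<longlonglongrightarrow> 0"
      by (rule summable_LIMSEQ_zero[OF summable_exp])
    from LIMSEQ_D[OF this, of "e / 4"]
    obtain n0 where n0: "\<And>n. n \<ge> n0 \<Longrightarrow> \<bar>inverse (fact n) * (\<bar>t\<bar> * R) ^ n\<bar> < e / 4"
      using e by auto
    define K where "K = n0"
    have "T K N \<le> (2 * \<bar>t\<bar> ^ (2*K) / fact (2*K)) * R ^ (2*K)"
      unfolding T_def by (intro mult_left_mono bound) simp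
    also have "\<dots> = 2 * (inverse (fact (2*K)) * (\<bar>t\<bar> * R) ^ (2*K))"
      by (simp add: power_mult_distrib divide_inverse)
    also have "\<dots> < 2 * (e / 4)"
      using n0[of "2*K"] by (auto simp: K_def)
    finally have TK: "2 * T K N < e" by simp
    have "(\<lambda>n. T K (M n) + cmod (S K (M n) - S K N) + T K N) \<longlonglongrightarrow> T K N + cmod (S K N - S K N) + T K N"
      unfolding T_def S_def by (intro tendsto_intros conv)
    then have "\<forall>\<^sub>F n in sequentially. T K (M n) + cmod (S K (M n) - S K N) + T K N < e"
      by (rule order_tendstoD) (use TK in simp)
    moreover have "dist (char (M n) t) (char N t) \<le> T K (M n) + cmod (S K (M n) - S K N) + T K N" for n
    proof -
      have "char (M n) t - char N t =
          (char (M n) t - S K (M n)) + (S K (M n) - S K N) - (char N t - S K N)" by simp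
      also have "cmod \<dots> \<le> cmod (char (M n) t - S K (M n)) + cmod (S K (M n) - S K N) + cmod (char N t - S K N)"
        by (meson add_mono norm_triangle_ineq norm_triangle_ineq4 order_refl order_trans)
      also have "\<dots> \<le> T K (M n) + cmod (S K (M n) - S K N) + T K N"
        using taylor[OF M intM, of n K] taylor[OF N intN, of K] by simp
      finally show ?thesis by (simp add: dist_norm)
    qed
    ultimately have "\<forall>\<^sub>F n in sequentially. dist (char (M n) t) (char N t) < e"
      by (auto elim!: eventually_mono intro: le_less_trans)
    then show "\<exists>no. \<forall>n\<ge>no. dist (char (M n) t) (char N t) < e"
      by (simp add: eventually_sequentially)
  qed
qed

section \<open>Moments of the semicircle law\<close>

definition semicircle_moment :: "nat \<Rightarrow> real" where
  "semicircle_moment n = (LINT x|semicircle_law. x ^ n)"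

lemma semicircle_density_nonneg: "semicircle_density x \<ge> 0"
proof -
  have "x\<^sup>2 \<le> 4" if "\<bar>x\<bar> \<le> 2"
    using that abs_le_square_iff[of x 2] by simp
  then show ?thesis by (simp add: semicircle_density_def)
qed

lemma semicircle_density_eq:
  "semicircle_density x = indicator {-2..2} x * (1 / (2 * pi) * sqrt (4 - x\<^sup>2))"
  by (auto simp: semicircle_density_def indicator_def)

lemma semicircle_density_measurable [measurable]: "semicircle_density \<in> borel_measurable borel"
  unfolding semicircle_density_eq[abs_def] by measurable

lemma semicircle_moment_integral:
  "integrable semicircle_law (\<lambda>x. x ^ n)"
  "semicircle_moment n = 1 / (2 * pi) * integral {-2..2} (\<lambda>x. x ^ n * sqrt (4 - x\<^sup>2))"
proof -
  let ?g = "\<lambda>x::real. 1 / (2 * pi) * (x ^ n * sqrt (4 - x\<^sup>2))"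
  have si: "set_integrable lborel {-2..2} ?g"
    by (intro borel_integrable_atLeastAtMost' continuous_intros)
  have eq: "indicator {-2..2} x *\<^sub>R ?g x = semicircle_density x *\<^sub>R x ^ n" for x
    by (simp add: semicircle_density_eq)
  have i: "integrable lborel (\<lambda>x. semicircle_density x *\<^sub>R x ^ n)"
    using si unfolding set_integrable_def eq .
  then show "integrable semicircle_law (\<lambda>x. x ^ n)"
    unfolding semicircle_law_def
    by (subst integrable_density) (auto simp: semicircle_density_nonneg)
  have "semicircle_moment n = (LINT x|lborel. semicircle_density x *\<^sub>R x ^ n)"
    unfolding semicircle_law_def semicircle_moment_def
    by (subst integral_density) (auto simp: semicircle_density_nonneg)
  also have "\<dots> = (LINT x:{-2..2}|lborel. ?g x)"
    unfolding set_lebesgue_integral_def eq ..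
  also have "\<dots> = integral {-2..2} ?g"
    by (rule set_borel_integral_eq_integral(2)[OF si])
  finally show "semicircle_moment n = 1 / (2 * pi) * integral {-2..2} (\<lambda>x. x ^ n * sqrt (4 - x\<^sup>2))"
    by simp
qed

lemma has_real_derivative_semicircle_sqrt:
  assumes "x \<in> {-2<..<2::real}"
  shows "((\<lambda>x. sqrt (4 - x\<^sup>2)) has_real_derivative (- x / sqrt (4 - x\<^sup>2))) (at x)" "4 - x\<^sup>2 > 0"
proof -
  have "x\<^sup>2 < 2\<^sup>2" using assms by (intro power2_strict_mono) auto
  then show pos: "4 - x\<^sup>2 > 0" by simp
  show "((\<lambda>x. sqrt (4 - x\<^sup>2)) has_real_derivative (- x / sqrt (4 - x\<^sup>2))) (at x)"
    using pos by (auto intro!: derivative_eq_intros simp: divide_simps)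
qed

text \<open>
  Integration by parts in disguise: the function \<open>x ^ (n + 1) * sqrt (4 - x\<^sup>2) ^ 3\<close> vanishes at
  both end points, and its derivative is the difference of the two integrands.
\<close>

lemma semicircle_moment_Suc_Suc:
  "(real n + 4) * semicircle_moment (n + 2) = 4 * (real n + 1) * semicircle_moment n"
proof -
  define J where "J n = integral {-2..2} (\<lambda>x::real. x ^ n * sqrt (4 - x\<^sup>2))" for n
  have J: "((\<lambda>x::real. x ^ n * sqrt (4 - x\<^sup>2)) has_integral J n) {-2..2}" for n
    unfolding J_def by (intro integrable_integral integrable_continuous_real continuous_intros)
  let ?F = "\<lambda>x::real. x ^ (n+1) * sqrt (4 - x\<^sup>2) ^ 3"
  let ?f = "\<lambda>x::real. 4 * (real n + 1) * (x ^ n * sqrt (4 - x\<^sup>2)) - (real n + 4) * (x ^ (n+2) * sqrt (4 - x\<^sup>2))"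
  have "(?f has_integral (?F 2 - ?F (-2))) {-2..2}"
  proof (rule fundamental_theorem_of_calculus_interior)
    fix x :: real assume x: "x \<in> {-2<..<2}"
    define r where "r = (\<lambda>x::real. sqrt (4 - x\<^sup>2))"
    define s where "s = r x"
    have s: "s > 0" "s\<^sup>2 = 4 - x\<^sup>2" using has_real_derivative_semicircle_sqrt(2)[OF x] by (auto simp: s_def r_def)
    have d: "(r has_real_derivative (- x / s)) (at x)"
      unfolding r_def s_def by (rule has_real_derivative_semicircle_sqrt(1)[OF x])
    have "((\<lambda>x. x ^ (n+1) * r x ^ 3) has_real_derivative
        ((real n + 1) * x ^ n * s ^ 3 + x ^ (n+1) * (3 * s\<^sup>2 * (- x / s)))) (at x)"
      by (rule derivative_eq_intros d refl)+ (simp add: s_def algebra_simps)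
    also have "(real n + 1) * x ^ n * s ^ 3 + x ^ (n+1) * (3 * s\<^sup>2 * (- x / s)) = 
        (real n + 1) * x ^ n * s * s\<^sup>2 - 3 * x ^ (n+2) * s"
      using s(1) by (simp add: power2_eq_square power3_eq_cube)
    also have "\<dots> = 4 * (real n + 1) * (x ^ n * s) - (real n + 4) * (x ^ (n+2) * s)"
      unfolding s(2) by (simp add: algebra_simps power2_eq_square)
    finally show "(?F has_vector_derivative ?f x) (at x)"
      unfolding s_def r_def by (simp add: has_real_derivative_iff_has_vector_derivative)
  qed (auto intro!: continuous_intros)
  moreover have "(?f has_integral (4 * (real n + 1) * J n - (real n + 4) * J (n+2))) {-2..2}"
    by (intro has_integral_diff has_integral_mult_right J)
  ultimately have "4 * (real n + 1) * J n - (real n + 4) * J (n+2) = ?F 2 - ?F (-2)"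
    using has_integral_unique by blast
  then have "(real n + 4) * J (n+2) = 4 * (real n + 1) * J n" by simp
  then have "1/(2*pi) * ((real n + 4) * J (n+2)) = 1/(2*pi) * (4 * (real n + 1) * J n)" by simp
  then show ?thesis by (simp add: semicircle_moment_integral(2) J_def mult_ac)
qed

lemma semicircle_moment_0: "semicircle_moment 0 = 1"
proof -
  let ?F = "\<lambda>x::real. x / 2 * sqrt (4 - x\<^sup>2) + 2 * arcsin (x / 2)"
  have "((\<lambda>x. sqrt (4 - x\<^sup>2)) has_integral (?F 2 - ?F (-2))) {-2..2}"
  proof (rule fundamental_theorem_of_calculus_interior)
    fix x :: real assume x: "x \<in> {-2<..<2}"
    define r where "r = (\<lambda>x::real. sqrt (4 - x\<^sup>2))"
    define s where "s = r x"
    have s: "s > 0" "s\<^sup>2 = 4 - x\<^sup>2" using has_real_derivative_semicircle_sqrt(2)[OF x] by (auto simp: s_def r_def)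
    have d: "(r has_real_derivative (- x / s)) (at x)"
      unfolding r_def s_def by (rule has_real_derivative_semicircle_sqrt(1)[OF x])
    have "sqrt (1 - (x/2)\<^sup>2) = s / 2"
      by (rule real_sqrt_unique) (use s in \<open>auto simp: power_divide divide_simps\<close>)
    define q where "q = (\<lambda>x::real. arcsin (x / 2))"
    have arc: "(q has_real_derivative (1 / s)) (at x)"
      unfolding q_def using \<open>sqrt (1 - (x/2)\<^sup>2) = s / 2\<close> x s(1) by (auto intro!: derivative_eq_intros simp: divide_simps)
    have "((\<lambda>x. x / 2 * r x + 2 * q x) has_real_derivative (1/2 * s + x / 2 * (- x / s) + 2 * (1 / s))) (at x)"
      by (auto intro!: derivative_eq_intros d arc simp: s_def)
    also have "1/2 * s + x / 2 * (- x / s) + 2 * (1 / s) = (s\<^sup>2 + (4 - x\<^sup>2)) / (2 * s)"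
      using s(1) by (simp add: field_simps power2_eq_square)
    also have "\<dots> = s" unfolding s(2)[symmetric] using s(1) by (simp add: power2_eq_square)
    finally show "(?F has_vector_derivative sqrt (4 - x\<^sup>2)) (at x)"
      unfolding s_def r_def q_def by (simp add: has_real_derivative_iff_has_vector_derivative)
  qed (auto intro!: continuous_intros)
  then show ?thesis by (simp add: semicircle_moment_integral(2) integral_unique)
qed

lemma semicircle_moment_1: "semicircle_moment 1 = 0"
proof -
  let ?F = "\<lambda>x::real. - (1/3) * sqrt (4 - x\<^sup>2) ^ 3"
  have "((\<lambda>x. x * sqrt (4 - x\<^sup>2)) has_integral (?F 2 - ?F (-2))) {-2..2}"
  proof (rule fundamental_theorem_of_calculus_interior)
    fix x :: real assume x: "x \<in> {-2<..<2}"
    define r where "r = (\<lambda>x::real. sqrt (4 - x\<^sup>2))"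
    have r: "r x > 0" using has_real_derivative_semicircle_sqrt(2)[OF x] by (auto simp: r_def)
    have d: "(r has_real_derivative (- x / r x)) (at x)"
      unfolding r_def by (rule has_real_derivative_semicircle_sqrt(1)[OF x])
    have "((\<lambda>x. - (1/3) * r x ^ 3) has_real_derivative (- (1/3) * (3 * r x ^ 2 * (- x / r x)))) (at x)"
      by (auto intro!: derivative_eq_intros d)
    also have "(- (1/3) * (3 * r x ^ 2 * (- x / r x))) = x * r x"
      using r by (simp add: power2_eq_square)
    finally show "(?F has_vector_derivative x * sqrt (4 - x\<^sup>2)) (at x)"
      unfolding r_def by (simp add: has_real_derivative_iff_has_vector_derivative)
  qed (auto intro!: continuous_intros)
  then show ?thesis by (simp add: semicircle_moment_integral(2) integral_unique)
qed

lemma semicircle_moment_odd: "odd n \<Longrightarrow> semicircle_moment n = 0"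
proof (induction n rule: nat_less_induct)
  case (1 n)
  then consider "n = 1" | k where "n = k + 2" "odd k"
    by (cases n; cases "n - 1") auto
  then show ?case
  proof cases
    case 2
    then have "semicircle_moment k = 0" using 1 by simp
    then have "(real k + 4) * semicircle_moment n = 0" using semicircle_moment_Suc_Suc[of k] 2 by simp
    then show ?thesis by simp
  qed (use semicircle_moment_1 in simp)
qed

lemma real_distribution_semicircle: "real_distribution semicircle_law"
proof -
  have "integrable semicircle_law (\<lambda>x. 1 :: real)" using semicircle_moment_integral(1)[of 0] by simp
  then have f: "finite_measure semicircle_law"
    by (intro finite_measureI) (auto simp: integrable_iff_bounded less_top)
  have "measure semicircle_law (space semicircle_law) = 1"
    using semicircle_moment_0 by (simp add: semicircle_moment_def)
  then have "prob_space semicircle_law"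
    using f by (intro prob_spaceI) (simp add: finite_measure.emeasure_eq_measure)
  then show ?thesis
    by (simp add: real_distribution_def real_distribution_axioms_def semicircle_law_def)
qed


section \<open>Catalan numbers\<close>

fun catalan :: "nat \<Rightarrow> nat" where
  "catalan 0 = 1"
| "catalan (Suc n) = (\<Sum>j\<le>n. catalan j * catalan (n - j))"

declare catalan.simps(2) [simp del]

text \<open>
  The convolution says that the generating function \<open>F\<close> satisfies \<open>F = 1 + X F\<^sup>2\<close>, that is,
  \<open>G = 1 - 2 X F\<close> is a square root of \<open>1 - 4 X\<close>. Such a \<open>G\<close> satisfies the linear differential
  equation \<open>(1 - 4 X) G' = - 2 G\<close>, whose coefficients are the claimed recursion.
\<close>

lemma catalan_linear_rec: "(real n + 2) * catalan (Suc n) = (4 * real n + 2) * catalan n"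
proof -
  define F where "F = Abs_fps (\<lambda>n. real (catalan n))"
  define G where "G = 1 - 2 * fps_X * F"
  have F: "F = 1 + fps_X * (F * F)"
  proof (rule fps_ext)
    fix n
    have "fps_nth (F * F) m = real (catalan (Suc m))" for m
      by (simp add: F_def fps_mult_nth catalan.simps(2) atMost_atLeast0)
    then show "fps_nth F n = fps_nth (1 + fps_X * (F * F)) n"
      by (cases n) (simp_all add: F_def)
  qed
  have "G * G = 1 - 4 * fps_X * (F - fps_X * (F * F))"
    by (simp add: G_def algebra_simps)
  also have "F - fps_X * (F * F) = 1" using F by (simp add: algebra_simps)
  finally have GG: "G * G = 1 - 4 * fps_X" by simp
  have "fps_deriv (G * G) = - 4" unfolding GG by simp
  then have "2 * (G * fps_deriv G) = - 4" by (simp add: mult.commute)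
  then have "2 * (G * fps_deriv G) = 2 * (- 2)" by simp
  then have dG: "G * fps_deriv G = - 2"
    by (metis mult_left_cancel zero_neq_numeral)
  have "(1 - 4 * fps_X) * fps_deriv G = G * (G * fps_deriv G)"
    by (simp add: GG[symmetric] mult.assoc)
  also have "\<dots> = - 2 * G" by (simp add: dG)
  finally have "fps_deriv G - 4 * (fps_X * fps_deriv G) = - 2 * G" by (simp add: algebra_simps)
  then have "fps_nth (fps_deriv G - 4 * (fps_X * fps_deriv G)) (Suc n) = fps_nth (- 2 * G) (Suc n)" by simp
  moreover have "fps_nth G (Suc n) = - 2 * real (catalan n)" for n
    by (simp add: G_def F_def mult.assoc numeral_fps_const)
  ultimately show ?thesis
    by (simp add: numeral_fps_const algebra_simps)
qed

section \<open>Counting noncrossing pairings\<close>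

definition odd_even_pair :: "nat set \<Rightarrow> bool" where
  "odd_even_pair V \<longleftrightarrow> (\<exists>a b. V = {a, b} \<and> a < b \<and> odd (a + b))"

lemma odd_even_pair_iff:
  "odd_even_pair V \<longleftrightarrow> card V = 2 \<and> card {v\<in>V. even v} = 1 \<and> card {v\<in>V. odd v} = 1"
proof
  assume "odd_even_pair V"
  then obtain a b where ab: "V = {a, b}" "a < b" "odd (a + b)"
    by (auto simp: odd_even_pair_def)
  show "card V = 2 \<and> card {v\<in>V. even v} = 1 \<and> card {v\<in>V. odd v} = 1"
  proof (cases "even a")
    case True
    then have "{v\<in>V. even v} = {a}" "{v\<in>V. odd v} = {b}" using ab by auto
    then show ?thesis using ab by simp
  next
    case False
    then have "{v\<in>V. even v} = {b}" "{v\<in>V. odd v} = {a}" using ab by auto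
    then show ?thesis using ab by simp
  qed
next
  assume V: "card V = 2 \<and> card {v\<in>V. even v} = 1 \<and> card {v\<in>V. odd v} = 1"
  then obtain x y where x: "{v\<in>V. even v} = {x}" and y: "{v\<in>V. odd v} = {y}"
    by (auto simp: card_1_singleton_iff)
  then have "V = {x, y}" "even x" "odd y" by blast+
  then have "V = {x, y} \<and> odd (x + y)" "V = {y, x} \<and> odd (y + x)" by auto
  moreover have "x < y \<or> y < x" using \<open>even x\<close> \<open>odd y\<close> by (cases x y rule: linorder_cases) auto
  ultimately show "odd_even_pair V" unfolding odd_even_pair_def by blast
qed

definition noncrossing :: "nat set set \<Rightarrow> bool" where
  "noncrossing \<pi> \<longleftrightarrow> (\<forall>a b c d. {a, b} \<in> \<pi> \<longrightarrow> {c, d} \<in> \<pi> \<longrightarrow> \<not> (a < c \<and> c < b \<and> b < d))"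

definition nc_pairings :: "nat set \<Rightarrow> nat set set set" where
  "nc_pairings A = {\<pi>. partition_on A \<pi> \<and> (\<forall>V\<in>\<pi>. odd_even_pair V) \<and> noncrossing \<pi>}"

lemma finite_nc_pairings: "finite A \<Longrightarrow> finite (nc_pairings A)"
  unfolding nc_pairings_def by (rule finite_subset[OF _ finitely_many_partition_on]) auto

lemma nc_pairings_empty: "nc_pairings {} = {{}}"
  by (auto simp: nc_pairings_def partition_on_empty noncrossing_def)

text \<open>
  Two noncrossing pairings, one of points below the arc from \<open>a\<close> to \<open>e\<close> and one of points to its
  right, combine with this arc to a noncrossing pairing, and the next lemma inverts this operation.
\<close>

lemma nc_pairings_join:
  assumes \<pi>: "\<pi>\<^sub>1 \<in> nc_pairings B" "\<pi>\<^sub>2 \<in> nc_pairings C"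
    and B: "\<And>x. x \<in> B \<Longrightarrow> a < x \<and> x < e" and C: "\<And>x. x \<in> C \<Longrightarrow> e < x"
    and ae: "a < e" "odd (a + e)"
  shows "insert {a, e} (\<pi>\<^sub>1 \<union> \<pi>\<^sub>2) \<in> nc_pairings (insert a (insert e (B \<union> C)))"
proof -
  have U: "\<Union>\<pi>\<^sub>1 = B" "\<Union>\<pi>\<^sub>2 = C" and nc: "noncrossing \<pi>\<^sub>1" "noncrossing \<pi>\<^sub>2"
    using \<pi> by (auto simp: nc_pairings_def partition_on_def)
  have BC: "B \<inter> C = {}" "a \<notin> B" "a \<notin> C" "e \<notin> B" "e \<notin> C" using B C ae by force+
  have "partition_on (insert a (insert e (B \<union> C))) (insert {a, e} (\<pi>\<^sub>1 \<union> \<pi>\<^sub>2))"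
  proof -
    have "disjoint \<pi>\<^sub>1" "disjoint \<pi>\<^sub>2" using \<pi> by (auto simp: nc_pairings_def partition_on_def)
    then have "disjoint (\<pi>\<^sub>1 \<union> \<pi>\<^sub>2)" using U BC by (intro disjoint_union) auto
    then have "partition_on (B \<union> C) (\<pi>\<^sub>1 \<union> \<pi>\<^sub>2)"
      using U \<pi> by (auto simp: nc_pairings_def partition_on_def)
    moreover have "disjnt {a, e} (\<Union>(\<pi>\<^sub>1 \<union> \<pi>\<^sub>2))" using U BC by (auto simp: disjnt_def)
    moreover have "insert a (insert e (B \<union> C)) - {a, e} = B \<union> C" using BC by auto
    ultimately show ?thesis by (subst partition_on_insert) auto
  qed
  moreover have "noncrossing (insert {a, e} (\<pi>\<^sub>1 \<union> \<pi>\<^sub>2))"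
    unfolding noncrossing_def
  proof (intro allI impI notI)
    fix p q r s assume P: "{p, q} \<in> insert {a, e} (\<pi>\<^sub>1 \<union> \<pi>\<^sub>2)" and Q: "{r, s} \<in> insert {a, e} (\<pi>\<^sub>1 \<union> \<pi>\<^sub>2)"
      and l: "p < r \<and> r < q \<and> q < s"
    have b: "{x, y} = {a, e} \<and> x = a \<and> y = e \<or> {x, y} \<in> \<pi>\<^sub>1 \<and> x \<in> B \<and> y \<in> B \<or> {x, y} \<in> \<pi>\<^sub>2 \<and> x \<in> C \<and> y \<in> C"
      if "{x, y} \<in> insert {a, e} (\<pi>\<^sub>1 \<union> \<pi>\<^sub>2)" "x < y" for x y
      using that U ae by (auto simp: doubleton_eq_iff)
    have nc': "\<not> ({p, q} \<in> \<pi>\<^sub>1 \<and> {r, s} \<in> \<pi>\<^sub>1)" "\<not> ({p, q} \<in> \<pi>\<^sub>2 \<and> {r, s} \<in> \<pi>\<^sub>2)"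
      using nc l unfolding noncrossing_def by blast+
    have "p < q" "r < s" using l by auto
    from b[OF P \<open>p < q\<close>] b[OF Q \<open>r < s\<close>] nc' l show False
      by (elim disjE conjE) (auto dest!: B C)
  qed
  moreover have "odd_even_pair {a, e}" using ae by (auto simp: odd_even_pair_def)
  ultimately show ?thesis using \<pi> by (auto simp: nc_pairings_def)
qed

lemma nc_pairings_split:
  assumes \<pi>: "\<pi> \<in> nc_pairings (insert a (insert e (B \<union> C)))" and ae: "{a, e} \<in> \<pi>"
    and B: "\<And>x. x \<in> B \<Longrightarrow> a < x \<and> x < e" and C: "\<And>x. x \<in> C \<Longrightarrow> e < x" and lt: "a < e"
  shows "{V\<in>\<pi>. V \<subseteq> B} \<in> nc_pairings B" "{V\<in>\<pi>. V \<subseteq> C} \<in> nc_pairings C"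
    "\<pi> = insert {a, e} ({V\<in>\<pi>. V \<subseteq> B} \<union> {V\<in>\<pi>. V \<subseteq> C})"
proof -
  have U: "\<Union>\<pi> = insert a (insert e (B \<union> C))" and d: "disjoint \<pi>" and ne: "{} \<notin> \<pi>"
    and nc: "noncrossing \<pi>" and pair: "\<And>V. V \<in> \<pi> \<Longrightarrow> odd_even_pair V"
    using \<pi> by (auto simp: nc_pairings_def partition_on_def)
  have BC: "B \<inter> C = {}" "a \<notin> B" "a \<notin> C" "e \<notin> B" "e \<notin> C" using B C lt by force+
  have cases: "V \<subseteq> B \<or> V \<subseteq> C" if V: "V \<in> \<pi>" "V \<noteq> {a, e}" for V
  proof -
    obtain c f where cf: "V = {c, f}" "c < f" using pair[OF V(1)] by (auto simp: odd_even_pair_def)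
    have "V \<inter> {a, e} = {}" using d V ae by (auto simp: disjoint_def)
    moreover have "V \<subseteq> insert a (insert e (B \<union> C))" using U V(1) by blast
    ultimately have sub: "c \<in> B \<union> C" "f \<in> B \<union> C" using cf by auto
    have "\<not> (a < c \<and> c < e \<and> e < f)" using nc ae V(1) cf unfolding noncrossing_def by blast
    then show ?thesis using sub cf B[of c] B[of f] C[of c] C[of f] by force
  qed
  then show "\<pi> = insert {a, e} ({V\<in>\<pi>. V \<subseteq> B} \<union> {V\<in>\<pi>. V \<subseteq> C})" using ae by blast
  have sub: "{V\<in>\<pi>. V \<subseteq> D} \<in> nc_pairings D" if D: "D = B \<and> E = C \<or> D = C \<and> E = B" for D E
  proof -
    have "\<Union>{V\<in>\<pi>. V \<subseteq> D} = D"
    proof (intro equalityI subsetI)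
      fix x assume x: "x \<in> D"
      then obtain V where V: "V \<in> \<pi>" "x \<in> V" using U D by blast
      moreover have "V \<noteq> {a, e}" using x V BC D by auto
      ultimately have "V \<subseteq> D" using cases[of V] x D BC by blast
      then show "x \<in> \<Union>{V\<in>\<pi>. V \<subseteq> D}" using V by blast
    qed auto
    then have "partition_on D {V\<in>\<pi>. V \<subseteq> D}"
      using d ne by (auto simp: partition_on_def disjoint_def)
    moreover have "noncrossing {V\<in>\<pi>. V \<subseteq> D}" using nc by (auto simp: noncrossing_def)
    ultimately show ?thesis using pair by (auto simp: nc_pairings_def)
  qed
  show "{V\<in>\<pi>. V \<subseteq> B} \<in> nc_pairings B" "{V\<in>\<pi>. V \<subseteq> C} \<in> nc_pairings C" using sub by blast+
qed

text \<open>
  The partner of the least element \<open>a\<close> has the form \<open>a + 2 j + 1\<close>, as the two have opposite parity.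
  The remaining points form one interval of length \<open>2 j\<close> and one of the complementary length, and
  the pairing restricts to each of them. Keeping the left end point arbitrary avoids any shifting of
  pairings, under which the roles of even and odd elements would change.
\<close>

lemma card_nc_pairings: "card (nc_pairings {a..<a + 2 * n}) = catalan n"
proof (induction n arbitrary: a rule: less_induct)
  case (less n)
  show ?case
  proof (cases n)
    case 0
    then show ?thesis by (simp add: nc_pairings_empty)
  next
    case (Suc m)
    define B where "B j = {a + 1..<a + 1 + 2 * j}" for j
    define C where "C j = {a + 2 * j + 2..<a + 2 * j + 2 + 2 * (m - j)}" for j
    define e where "e j = a + 2 * j + 1" for j
    define join where "join j = (\<lambda>(\<pi>\<^sub>1, \<pi>\<^sub>2). insert {a, e j} (\<pi>\<^sub>1 \<union> \<pi>\<^sub>2))" for j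
    define P where "P j = nc_pairings (B j) \<times> nc_pairings (C j)" for j
    have B: "a < x \<and> x < e j" if "x \<in> B j" for x j using that by (auto simp: B_def e_def)
    have C: "e j < x" if "x \<in> C j" for x j using that by (auto simp: C_def e_def)
    have ae: "a < e j" "odd (a + e j)" for j by (auto simp: e_def)
    have A: "{a..<a + 2 * n} = insert a (insert (e j) (B j \<union> C j))" if "j \<le> m" for j
      using that unfolding Suc by (auto simp: B_def C_def e_def)
    have dis: "a \<notin> B j" "a \<notin> C j" "B j \<inter> C j = {}" for j by (auto simp: B_def C_def)
    have "nc_pairings {a..<a + 2 * n} = (\<Union>j\<in>{..m}. join j ` P j)"
    proof (intro equalityI subsetI)
      fix \<pi> assume \<pi>: "\<pi> \<in> nc_pairings {a..<a + 2 * n}"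
      have "a \<in> \<Union>\<pi>" using \<pi> Suc by (auto simp: nc_pairings_def partition_on_def)
      then obtain V where V: "V \<in> \<pi>" "a \<in> V" by blast
      have sub: "V \<subseteq> {a..<a + 2 * n}" using \<pi> V by (auto simp: nc_pairings_def partition_on_def)
      have "odd_even_pair V" using \<pi> V by (auto simp: nc_pairings_def)
      then obtain b c where bc: "V = {b, c}" "b < c" "odd (b + c)"
        unfolding odd_even_pair_def by blast
      have "b = a" using bc sub V by auto
      then have "a < c" "c < a + 2 * n" "odd (a + c)" using bc sub by auto
      moreover obtain i where i: "c = a + Suc i" using \<open>a < c\<close> less_iff_Suc_add by auto
      ultimately have "even i" using i by (cases "even a") auto
      then obtain j where "i = 2 * j" by blast
      with i have c: "c = e j" by (simp add: e_def)
      have j: "j \<le> m" using \<open>c < a + 2 * n\<close> c Suc by (auto simp: e_def)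
      have aeV: "{a, e j} \<in> \<pi>" using V bc \<open>b = a\<close> c by simp
      note split = nc_pairings_split[OF \<pi>[unfolded A[OF j]] aeV B C ae(1), simplified]
      have "\<pi> = join j ({V\<in>\<pi>. V \<subseteq> B j}, {V\<in>\<pi>. V \<subseteq> C j})"
        using split(3) by (simp add: join_def)
      moreover have "({V\<in>\<pi>. V \<subseteq> B j}, {V\<in>\<pi>. V \<subseteq> C j}) \<in> P j" using split(1,2) by (simp add: P_def)
      ultimately show "\<pi> \<in> (\<Union>j\<in>{..m}. join j ` P j)" using j by blast
    next
      fix \<pi> assume "\<pi> \<in> (\<Union>j\<in>{..m}. join j ` P j)"
      then obtain j \<pi>\<^sub>1 \<pi>\<^sub>2 where j: "j \<le> m" and p: "\<pi>\<^sub>1 \<in> nc_pairings (B j)" "\<pi>\<^sub>2 \<in> nc_pairings (C j)"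
        and "\<pi> = insert {a, e j} (\<pi>\<^sub>1 \<union> \<pi>\<^sub>2)" by (auto simp: join_def P_def)
      then show "\<pi> \<in> nc_pairings {a..<a + 2 * n}"
        unfolding A[OF j] using nc_pairings_join[OF p B C ae, of j] by simp
    qed
    also have "card \<dots> = (\<Sum>j\<le>m. card (join j ` P j))"
    proof (rule card_UN_disjoint)
      show "\<forall>i\<in>{..m}. finite (join i ` P i)"
        by (auto simp: P_def B_def C_def intro!: finite_nc_pairings)
      show "\<forall>i\<in>{..m}. \<forall>j\<in>{..m}. i \<noteq> j \<longrightarrow> join i ` P i \<inter> join j ` P j = {}"
      proof (intro ballI impI)
        fix i j :: nat assume "i \<noteq> j"
        have *: "V = {a, e j}" if "\<pi> \<in> join j ` P j" "V \<in> \<pi>" "a \<in> V" for \<pi> V j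
        proof -
          obtain \<pi>\<^sub>1 \<pi>\<^sub>2 where p: "\<pi>\<^sub>1 \<in> nc_pairings (B j)" "\<pi>\<^sub>2 \<in> nc_pairings (C j)"
            and \<pi>: "\<pi> = insert {a, e j} (\<pi>\<^sub>1 \<union> \<pi>\<^sub>2)" using \<open>\<pi> \<in> join j ` P j\<close> by (auto simp: join_def P_def)
          have "\<Union>\<pi>\<^sub>1 = B j" "\<Union>\<pi>\<^sub>2 = C j" using p by (auto simp: nc_pairings_def partition_on_def)
          then have "V \<notin> \<pi>\<^sub>1" "V \<notin> \<pi>\<^sub>2" using \<open>a \<in> V\<close> dis[of j] by blast+
          then show ?thesis using \<pi> \<open>V \<in> \<pi>\<close> by blast
        qed
        have "{a, e j} \<noteq> {a, e i}" using \<open>i \<noteq> j\<close> by (auto simp: e_def doubleton_eq_iff)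
        moreover have "{a, e j} \<in> \<pi>" if "\<pi> \<in> join j ` P j" for \<pi> using that by (auto simp: join_def)
        ultimately have "\<pi> \<notin> join j ` P j" if "\<pi> \<in> join i ` P i" for \<pi>
          using *[OF that, of "{a, e j}"] by auto
        then show "join i ` P i \<inter> join j ` P j = {}" by blast
      qed
    qed auto
    also have "\<dots> = (\<Sum>j\<le>m. catalan j * catalan (m - j))"
    proof (rule sum.cong[OF refl])
      fix j assume "j \<in> {..m}"
      then have j: "j \<le> m" by simp
      have "inj_on (join j) (P j)"
      proof (rule inj_on_inverseI)
        fix x assume "x \<in> P j"
        then obtain \<pi>\<^sub>1 \<pi>\<^sub>2 where x: "x = (\<pi>\<^sub>1, \<pi>\<^sub>2)" and p: "\<pi>\<^sub>1 \<in> nc_pairings (B j)" "\<pi>\<^sub>2 \<in> nc_pairings (C j)"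
          by (auto simp: P_def)
        have U: "W \<subseteq> B j \<and> W \<noteq> {}" if "W \<in> \<pi>\<^sub>1" for W
          using p(1) that by (auto simp: nc_pairings_def partition_on_def)
        have U': "W \<subseteq> C j \<and> W \<noteq> {}" if "W \<in> \<pi>\<^sub>2" for W
          using p(2) that by (auto simp: nc_pairings_def partition_on_def)
        have BC: "\<not> (W \<subseteq> B j \<and> W \<subseteq> C j \<and> W \<noteq> {})" for W using dis(3)[of j] by blast
        have "(V \<subseteq> B j \<longleftrightarrow> V \<in> \<pi>\<^sub>1) \<and> (V \<subseteq> C j \<longleftrightarrow> V \<in> \<pi>\<^sub>2)" if V: "V \<in> join j x" for V
        proof -
          consider "V = {a, e j}" | "V \<in> \<pi>\<^sub>1" | "V \<in> \<pi>\<^sub>2" using V by (auto simp: join_def x)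
          then show ?thesis
          proof cases
            case 1
            then have "\<not> V \<subseteq> B j" "\<not> V \<subseteq> C j" using dis(1,2)[of j] by auto
            then show ?thesis using U[of V] U'[of V] by blast
          next
            case 2
            then show ?thesis using U[of V] U'[of V] BC[of V] by blast
          next
            case 3
            then show ?thesis using U[of V] U'[of V] BC[of V] by blast
          qed
        qed
        then have "{V\<in>join j x. V \<subseteq> B j} = \<pi>\<^sub>1" "{V\<in>join j x. V \<subseteq> C j} = \<pi>\<^sub>2"
          by (auto simp: join_def x)
        then show "({V\<in>join j x. V \<subseteq> B j}, {V\<in>join j x. V \<subseteq> C j}) = x" by (simp add: x)
      qed
      then have "card (join j ` P j) = card (P j)" by (rule card_image)
      also have "\<dots> = catalan j * catalan (m - j)"
        using less.IH[of j "a + 1"] less.IH[of "m - j" "a + 2 * j + 2"] j Suc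
        by (simp add: P_def B_def C_def card_cartesian_product)
      finally show "card (join j ` P j) = catalan j * catalan (m - j)" .
    qed
    finally show ?thesis by (simp add: Suc catalan.simps(2))
  qed
qed

section \<open>The volume attached to a rooted tree\<close>

text \<open>
  Regard \<open>0, \<dots>, n\<close> as the vertices of a tree with root \<open>0\<close>, in which \<open>p i\<close> is the parent of \<open>i\<close>,
  and \<open>x i\<close> as the signed increment along the edge from \<open>p i\<close> to \<open>i\<close>. The last vertex is a leaf, so the
  last variable occurs in one factor only, where it integrates to \<open>1\<close> by translation and reflection
  invariance.
\<close>

lemma nn_integral_tree_indicator:
  fixes z :: "(nat \<Rightarrow> real) \<Rightarrow> nat \<Rightarrow> real" and s :: "nat \<Rightarrow> real"
  assumes z0: "\<And>x. z x 0 = x 0"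
    and z: "\<And>x i. i \<in> {1..n} \<Longrightarrow> z x i = z x (p i) + s i * x i"
    and p: "\<And>i. i \<in> {1..n} \<Longrightarrow> p i < i" and s: "\<And>i. i \<in> {1..n} \<Longrightarrow> s i = 1 \<or> s i = -1"
  shows "(\<lambda>x. \<Prod>i\<le>n. indicator {0..1} (z x i) :: ennreal) \<in> borel_measurable (\<Pi>\<^sub>M l\<in>{0..n}. lborel)" (is ?meas)
    and "(\<integral>\<^sup>+x. (\<Prod>i\<le>n. indicator {0..1} (z x i)) \<partial>(\<Pi>\<^sub>M l\<in>{0..n}. lborel)) = 1" (is ?int)
proof -
  have loc: "z (x(j := y)) i = z x i" if "i < j" "i \<le> n" for x i j y
    using that
  proof (induction i rule: less_induct)
    case (less i)
    show ?case
    proof (cases "i = 0")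
      case False
      then have i: "i \<in> {1..n}" using less.prems by simp
      have "z (x(j := y)) (p i) = z x (p i)"
        by (rule less.IH) (use p[OF i] less.prems in auto)
      moreover have "(x(j := y)) i = x i" using less.prems by simp
      ultimately show ?thesis by (simp only: z[OF i])
    qed (use less.prems z0 in simp)
  qed
  have zm [measurable]: "(\<lambda>x. z x i) \<in> borel_measurable (\<Pi>\<^sub>M l\<in>{0..m}. lborel)" if "i \<le> m" "m \<le> n" for i m
    using that
  proof (induction i rule: less_induct)
    case (less i)
    have c: "(\<lambda>x. x i) \<in> borel_measurable (\<Pi>\<^sub>M l\<in>{0..m}. lborel)"
      using measurable_component_singleton[of i "{0..m}" "\<lambda>_. lborel :: real measure"] less.prems by simp
    show ?case
    proof (cases "i = 0")
      case True
      then show ?thesis using c by (simp add: z0)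
    next
      case False
      then have i: "i \<in> {1..n}" using less.prems by simp
      have "(\<lambda>x. z x (p i)) \<in> borel_measurable (\<Pi>\<^sub>M l\<in>{0..m}. lborel)"
        using less p[OF i] by simp
      then have "(\<lambda>x. z x (p i) + s i * x i) \<in> borel_measurable (\<Pi>\<^sub>M l\<in>{0..m}. lborel)"
        using c by measurable
      then show ?thesis using z[OF i] by simp
    qed
  qed
  have m: "(\<lambda>x. \<Prod>i\<le>m. indicator {0..1} (z x i) :: ennreal) \<in> borel_measurable (\<Pi>\<^sub>M l\<in>{0..m}. lborel)"
    if "m \<le> n" for m
  proof (rule borel_measurable_prod_ennreal)
    fix i assume "i \<in> {..m}"
    then have "(\<lambda>x. z x i) \<in> borel_measurable (\<Pi>\<^sub>M l\<in>{0..m}. lborel)" using zm that by simp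
    then show "(\<lambda>x. indicator {0..1} (z x i) :: ennreal) \<in> borel_measurable (\<Pi>\<^sub>M l\<in>{0..m}. lborel)"
      by (rule measurable_compose) measurable
  qed
  from m[of n] show ?meas by simp
  interpret product_sigma_finite "\<lambda>_::nat. lborel :: real measure" by standard
  have "(\<integral>\<^sup>+x. (\<Prod>i\<le>m. indicator {0..1} (z x i)) \<partial>(\<Pi>\<^sub>M l\<in>{0..m}. lborel)) = 1" if "m \<le> n" for m
    using that
  proof (induction m)
    case 0
    have "(\<integral>\<^sup>+x. indicator {0..1} (x 0) \<partial>(\<Pi>\<^sub>M l\<in>{0::nat}. lborel :: real measure)) = (\<integral>\<^sup>+x. indicator {0..1::real} x \<partial>lborel)"
      by (rule product_nn_integral_singleton) simp
    then show ?case by (simp add: z0)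
  next
    case (Suc m)
    let ?j = "Suc m"
    have j: "?j \<in> {1..n}" using Suc.prems by simp
    have slice: "(\<integral>\<^sup>+y. indicator {0..1} (c + s ?j * y) \<partial>lborel) = 1" for c
    proof -
      have "(\<integral>\<^sup>+y. indicator {0..1::real} y \<partial>lborel) = ennreal \<bar>s ?j\<bar> * (\<integral>\<^sup>+y. indicator {0..1} (c + s ?j * y) \<partial>lborel)"
        by (rule nn_integral_real_affine) (use s[OF j] in auto)
      moreover have "\<bar>s ?j\<bar> = 1" using s[OF j] by auto
      ultimately show ?thesis by simp
    qed
    have I: "{0..Suc m} = insert (Suc m) {0..m}" by auto
    have "(\<integral>\<^sup>+x. (\<Prod>i\<le>Suc m. indicator {0..1} (z x i)) \<partial>(\<Pi>\<^sub>M l\<in>{0..Suc m}. lborel)) =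
      (\<integral>\<^sup>+x. (\<integral>\<^sup>+y. (\<Prod>i\<le>Suc m. indicator {0..1} (z (x(Suc m := y)) i)) \<partial>lborel) \<partial>(\<Pi>\<^sub>M l\<in>{0..m}. lborel))"
      unfolding I by (rule product_nn_integral_insert) (use m[OF Suc.prems] in \<open>auto simp: I\<close>)
    also have "\<dots> = (\<integral>\<^sup>+x. (\<integral>\<^sup>+y. (\<Prod>i\<le>m. indicator {0..1} (z x i)) * indicator {0..1} (z x (p ?j) + s ?j * y) \<partial>lborel)
        \<partial>(\<Pi>\<^sub>M l\<in>{0..m}. lborel))"
    proof (intro nn_integral_cong)
      fix x y
      have "z (x(Suc m := y)) ?j = z x (p ?j) + s ?j * y"
        using z[OF j] loc[of "p ?j" ?j x y] p[OF j] Suc.prems by simp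
      then show "(\<Prod>i\<le>Suc m. indicator {0..1} (z (x(Suc m := y)) i)) =
          (\<Prod>i\<le>m. indicator {0..1} (z x i)) * (indicator {0..1} (z x (p ?j) + s ?j * y) :: ennreal)"
        using loc[of _ ?j x y] Suc.prems by simp
    qed
    also have "\<dots> = (\<integral>\<^sup>+x. (\<Prod>i\<le>m. indicator {0..1} (z x i)) * (\<integral>\<^sup>+y. indicator {0..1} (z x (p ?j) + s ?j * y) \<partial>lborel)
        \<partial>(\<Pi>\<^sub>M l\<in>{0..m}. lborel))"
      by (intro nn_integral_cong nn_integral_cmult) measurable
    also have "\<dots> = (\<integral>\<^sup>+x. (\<Prod>i\<le>m. indicator {0..1} (z x i)) \<partial>(\<Pi>\<^sub>M l\<in>{0..m}. lborel))"
      by (simp only: slice mult_1_right)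
    finally show ?case using Suc by simp
  qed
  from this[of n] show ?int by simp
qed

section \<open>Walks compatible with a pairing\<close>

locale odd_even_pairing =
  fixes k :: nat and \<pi> :: "nat set set"
  assumes pairing: "\<pi> \<in> odd_even_pairings k"
begin

abbreviation "Pos \<equiv> {1..2 * k}"

definition partner :: "nat \<Rightarrow> nat" where
  "partner q = (THE r. {q, r} \<in> \<pi>)"

lemma blocks: "\<Union>\<pi> = Pos" "disjoint \<pi>" "V \<in> \<pi> \<Longrightarrow> odd_even_pair V"
  using pairing by (auto simp: odd_even_pairings_def odd_even_pair_iff partition_on_def)

lemma block_unique: "{q, r} \<in> \<pi> \<Longrightarrow> {q, r'} \<in> \<pi> \<Longrightarrow> r = r'"
proof -
  assume *: "{q, r} \<in> \<pi>" "{q, r'} \<in> \<pi>"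
  have "{q, r} = {q, r'}"
  proof (rule ccontr)
    assume "{q, r} \<noteq> {q, r'}"
    from disjointD[OF blocks(2) * this] show False by simp
  qed
  then show "r = r'" by (auto simp: doubleton_eq_iff)
qed

lemma partner_eqI: "{q, r} \<in> \<pi> \<Longrightarrow> partner q = r"
  unfolding partner_def by (rule the_equality) (auto intro: block_unique)

lemma partner_block:
  assumes "q \<in> Pos" shows "{q, partner q} \<in> \<pi>"
proof -
  obtain V where V: "V \<in> \<pi>" "q \<in> V" using assms blocks(1) by blast
  then obtain r where "V = {q, r}" using blocks(3)[OF V(1)] by (auto simp: odd_even_pair_def)
  then show ?thesis using V partner_eqI by auto
qed

lemma block_iff: "{a, b} \<in> \<pi> \<longleftrightarrow> a \<in> Pos \<and> b = partner a"
  using partner_block partner_eqI blocks(1) by blast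

lemma partner:
  assumes "q \<in> Pos"
  shows "partner q \<in> Pos" "partner (partner q) = q" "odd (q + partner q)" "partner q \<noteq> q"
proof -
  note b = partner_block[OF assms]
  show "partner q \<in> Pos" using b blocks(1) by blast
  show "partner (partner q) = q" using b by (intro partner_eqI) (simp add: insert_commute)
  show odd: "odd (q + partner q)" using blocks(3)[OF b]
    by (auto simp: odd_even_pair_def doubleton_eq_iff)
  then show "partner q \<noteq> q" by auto
qed

text \<open>
  The smaller element of each block represents the block: it is where a walk uses the block for the
  first time.
\<close>

definition Openers :: "nat set" where
  "Openers = {q\<in>Pos. q < partner q}"

definition opener :: "nat \<Rightarrow> nat" where
  "opener q = min q (partner q)"

lemma finite_Openers [simp]: "finite Openers" by (simp add: Openers_def)

lemma Openers_subset_Pos: "a \<in> Openers \<Longrightarrow> a \<in> Pos" by (simp add: Openers_def)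

lemma opener_in: "q \<in> Pos \<Longrightarrow> opener q \<in> Openers"
  using partner[of q] by (auto simp: Openers_def opener_def min_def)

lemma opener_Openers: "a \<in> Openers \<Longrightarrow> opener a = a" "a \<in> Openers \<Longrightarrow> opener (partner a) = a"
  using partner(2)[of a] by (auto simp: Openers_def opener_def)

lemma opener_cases:
  assumes "q \<in> Pos"
  obtains "q \<in> Openers" | a where "a \<in> Openers" "q = partner a" "a < q"
  using assms partner[OF assms] unfolding Openers_def
  by (metis (mono_tags, lifting) linorder_neqE_nat mem_Collect_eq)

lemma card_Openers: "card Openers = k"
proof -
  have U: "Pos = Openers \<union> partner ` Openers"
    using partner(1) Openers_subset_Pos by (blast elim: opener_cases)
  have "inj_on partner Openers"
    by (rule inj_on_inverseI[of _ partner]) (use partner(2) Openers_subset_Pos in blast)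
  moreover have "Openers \<inter> partner ` Openers = {}"
    using partner(2) by (fastforce simp: Openers_def)
  ultimately have "card Pos = card Openers + card Openers"
    by (subst U) (simp add: card_Un_disjoint card_image)
  then show ?thesis by simp
qed

text \<open>The tuples counted by \<open>r_count\<close>, with the condition on blocks expressed through partners.\<close>

definition labelings :: "nat \<Rightarrow> (nat \<Rightarrow> nat) set" where
  "labelings m = {t \<in> Pos \<rightarrow>\<^sub>E {1..m}. \<forall>a\<in>Pos.
       (t a = t (partner a) \<and> t (cyclic_next k a) = t (cyclic_next k (partner a))) \<or>
       (t a = t (cyclic_next k (partner a)) \<and> t (cyclic_next k a) = t (partner a))}"

lemma r_count_eq: "r_count m k \<pi> = card (labelings m)"
  unfolding r_count_def labelings_def by (rule arg_cong[of _ _ card]) (auto simp: block_iff)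

lemma finite_labelings: "finite (labelings m)"
  unfolding labelings_def by (rule finite_subset[of _ "Pos \<rightarrow>\<^sub>E {1..m}"]) (auto intro!: finite_PiE)

text \<open>
  Increments are integers and not naturals, so that the two edges of a block have increments that
  agree up to sign and increments along a closed piece of the walk add up to zero.
\<close>

definition step :: "(nat \<Rightarrow> nat) \<Rightarrow> nat \<Rightarrow> int" where
  "step t q = int (t (cyclic_next k q)) - int (t q)"

lemma labeling_cases:
  assumes "t \<in> labelings m" "a \<in> Pos"
  shows "(t a = t (partner a) \<and> t (cyclic_next k a) = t (cyclic_next k (partner a))) \<or>
       (t a = t (cyclic_next k (partner a)) \<and> t (cyclic_next k a) = t (partner a))"
  using assms unfolding labelings_def by blast

lemma step_partner:
  "t \<in> labelings m \<Longrightarrow> q \<in> Pos \<Longrightarrow> step t (partner q) = step t q \<or> step t (partner q) = - step t q"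
  using labeling_cases[of t m q] by (auto simp: step_def)

lemma step_opener:
  assumes "t \<in> labelings m" "q \<in> Pos"
  shows "step t q = step t (opener q) \<or> step t q = - step t (opener q)"
  using step_partner[OF assms] by (auto simp: opener_def min_def)

lemma sum_step:
  assumes "u \<le> v" "v \<le> 2 * k"
  shows "(\<Sum>q\<in>{u..<v}. step t q) = int (t v) - int (t u)"
proof -
  have "(\<Sum>q\<in>{u..<v}. step t q) = (\<Sum>q\<in>{u..<v}. int (t (Suc q)) - int (t q))"
    by (rule sum.cong) (use assms in \<open>auto simp: step_def cyclic_next_def\<close>)
  also have "\<dots> = int (t v) - int (t u)"
    using assms(1) by (rule sum_Suc_diff')
  finally show ?thesis .
qed

text \<open>
  A walk that returns at time \<open>v\<close> to its position at time \<open>u\<close> satisfies a linear relation between its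
  increments. If the block of \<open>c\<close> occurs in this relation only once, its increment is a function of
  the others, and the walk is determined by the signs, the starting point and \<open>k - 1\<close> increments, each
  of which has at most \<open>2 m + 1\<close> values.
\<close>

lemma card_labelings_closed_subwalk:
  assumes uv: "u \<in> Pos" "v \<in> Pos" and c: "c \<in> {u..<v}" "partner c \<notin> {u..<v}"
  shows "card {t \<in> labelings m. t u = t v} \<le> 4 ^ k * (m * (2 * m + 1) ^ (k - 1))"
proof -
  define w where "w = opener c"
  define I where "I = Openers - {w}"
  \<comment> \<open>\<open>E t\<close> records the signs: it is the set of positions whose increment is that of the opener.\<close>
  define E where "E t = {q\<in>Pos. step t q = step t (opener q)}" for t
  define \<Phi> where "\<Phi> t = (E t, t 1, restrict (step t) I)" for t
  let ?T = "{t \<in> labelings m. t u = t v}"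
  let ?B = "Pow Pos \<times> {1..m} \<times> (I \<rightarrow>\<^sub>E {- int m..int m})"
  have cP: "c \<in> Pos" using c uv by auto
  have wO: "w \<in> Openers" using cP by (simp add: w_def opener_in)
  have "inj_on \<Phi> ?T"
  proof (rule inj_onI)
    fix t s assume t: "t \<in> ?T" and s: "s \<in> ?T" and eq: "\<Phi> t = \<Phi> s"
    have E: "E t = E s" and t1: "t 1 = s 1" and res: "restrict (step t) I = restrict (step s) I"
      using eq by (auto simp: \<Phi>_def)
    have sgn: "step x q = (if q \<in> E x then step x (opener q) else - step x (opener q))"
      if "q \<in> Pos" "x \<in> ?T" for q x
      using step_opener[of x m q] that by (auto simp: E_def)
    have other: "step t q = step s q" if q: "q \<in> Pos" "opener q \<noteq> w" for q
    proof -
      have "opener q \<in> I" using q opener_in by (simp add: I_def)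
      then have "step t (opener q) = step s (opener q)" using fun_cong[OF res, of "opener q"] by simp
      then show ?thesis using sgn[OF q(1) t] sgn[OF q(1) s] E by simp
    qed
    have stepc: "step x c = - (\<Sum>q\<in>{u..<v} - {c}. step x q)" if "x \<in> ?T" for x
    proof -
      have "(\<Sum>q\<in>{u..<v}. step x q) = 0" using sum_step[of u v x] c uv that by auto
      then show ?thesis using c(1) by (subst (asm) sum.remove[of _ c]) auto
    qed
    have "step t c = step s c"
    proof -
      have "(\<Sum>q\<in>{u..<v} - {c}. step t q) = (\<Sum>q\<in>{u..<v} - {c}. step s q)"
      proof (rule sum.cong[OF refl])
        fix q assume q: "q \<in> {u..<v} - {c}"
        then have qP: "q \<in> Pos" using uv by auto
        have "opener q \<noteq> w"
        proof
          assume "opener q = w"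
          then have "q = c \<or> q = partner c \<or> partner q = c \<or> partner q = partner c"
            unfolding w_def opener_def min_def by (auto split: if_splits)
          then have "q = c \<or> q = partner c" using partner(2)[OF qP] partner(2)[OF cP] by metis
          then show False using q c by auto
        qed
        then show "step t q = step s q" using other qP by simp
      qed
      then show ?thesis using stepc[OF t] stepc[OF s] by simp
    qed
    then have stepw: "step t w = step s w"
      using sgn[OF cP t] sgn[OF cP s] E unfolding w_def by (auto split: if_splits)
    have all: "step t q = step s q" if q: "q \<in> Pos" for q
    proof (cases "opener q = w")
      case True
      then show ?thesis using sgn[OF q t] sgn[OF q s] E stepw by simp
    qed (use other q in simp)
    have "t q = s q" if "q \<in> Pos" for q
    proof -
      have "int (t q) - int (t 1) = int (s q) - int (s 1)"
        using that by (subst (1 2) sum_step[symmetric]) (auto intro!: sum.cong all)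
      then show ?thesis using t1 by simp
    qed
    moreover have "t \<in> extensional Pos" "s \<in> extensional Pos"
      using t s by (auto simp: labelings_def PiE_def)
    ultimately show "t = s" by (intro extensionalityI)
  qed
  moreover have "\<Phi> ` ?T \<subseteq> ?B"
  proof (intro image_subsetI)
    fix t assume t: "t \<in> ?T"
    then have tr: "t q \<in> {1..m}" if "q \<in> Pos" for q using that by (auto simp: labelings_def)
    have "step t q \<in> {- int m..int m}" if "q \<in> I" for q
    proof -
      have q: "q \<in> Pos" using that Openers_subset_Pos unfolding I_def by blast
      then have "cyclic_next k q \<in> Pos" by (auto simp: cyclic_next_def)
      then show ?thesis using tr[OF q] tr[of "cyclic_next k q"] by (auto simp: step_def)
    qed
    moreover have "1 \<in> Pos" using cP by auto
    ultimately show "\<Phi> t \<in> ?B" using tr[of 1] by (auto simp: \<Phi>_def E_def)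
  qed
  moreover have "finite ?B" unfolding I_def by (intro finite_cartesian_product finite_PiE) auto
  ultimately have "card ?T \<le> card ?B" by (rule card_inj_on_le)
  also have "card ?B = 4 ^ k * (m * (2 * m + 1) ^ (k - 1))"
  proof -
    have "card I = k - 1" using wO by (simp add: I_def card_Openers)
    moreover have "card {- int m..int m} = 2 * m + 1" by simp
    moreover have "(2::nat) ^ (2 * k) = 4 ^ k" by (simp add: power_mult)
    ultimately show ?thesis
      by (simp add: card_cartesian_product card_Pow card_funcsetE I_def)
  qed
  finally show ?thesis .
qed

text \<open>
  Walks that traverse a block twice in the same direction satisfy \<open>t a = t (partner a)\<close>. The piece
  from \<open>a\<close> to \<open>partner a\<close> is then closed, and it uses the edge at \<open>a\<close> but not the one at \<open>partner a\<close>.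
\<close>

lemma card_labelings_parallel:
  assumes "a \<in> Openers"
  shows "card {t \<in> labelings m. t a = t (partner a)} \<le> 4 ^ k * (m * (2 * m + 1) ^ (k - 1))"
  by (rule card_labelings_closed_subwalk[where c = a]) (use assms partner in \<open>auto simp: Openers_def\<close>)

text \<open>
  If a block \<open>{a, b}\<close> is traversed in opposite directions, then the piece from \<open>a + 1\<close> to \<open>b\<close> is
  closed, and a block that crosses \<open>{a, b}\<close> meets it in exactly one edge.
\<close>

lemma r_count_crossing:
  assumes "\<not> noncrossing \<pi>"
  shows "r_count m k \<pi> \<le> 2 * (4 ^ k * (m * (2 * m + 1) ^ (k - 1)))"
proof -
  obtain a b c d where "{a, b} \<in> \<pi>" "{c, d} \<in> \<pi>" and l: "a < c" "c < b" "b < d"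
    using assms by (auto simp: noncrossing_def)
  then have P: "a \<in> Pos" "c \<in> Pos" and b: "b = partner a" and d: "d = partner c"
    by (auto simp: block_iff)
  have bP: "b \<in> Pos" using partner(1)[OF P(1)] b by simp
  have "a \<in> Openers" using P b l by (auto simp: Openers_def)
  let ?A = "{t \<in> labelings m. t a = t b}" and ?B = "{t \<in> labelings m. t (a + 1) = t b}"
  have "labelings m \<subseteq> ?A \<union> ?B"
    using P(1) l bP b by (auto simp: labelings_def cyclic_next_def)
  then have "r_count m k \<pi> \<le> card (?A \<union> ?B)"
    unfolding r_count_eq using finite_labelings by (intro card_mono) auto
  also have "\<dots> \<le> card ?A + card ?B" by (rule card_Un_le)
  also have "card ?A \<le> 4 ^ k * (m * (2 * m + 1) ^ (k - 1))"
    using card_labelings_parallel[OF \<open>a \<in> Openers\<close>, of m] b by simp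
  also have "card ?B \<le> 4 ^ k * (m * (2 * m + 1) ^ (k - 1))"
    by (rule card_labelings_closed_subwalk[where c = c]) (use P bP d l in auto)
  finally show ?thesis by simp
qed

section \<open>The tree of a noncrossing pairing\<close>

text \<open>
  In the noncrossing case the positions \<open>0, \<dots>, 2 k\<close> are visited by a walk around a plane tree whose
  vertices are the openers and the root \<open>0\<close>: after \<open>q\<close> steps the walk stands at the opener of the
  innermost block that is still open, and at the root if there is none.
\<close>

definition innermost :: "nat \<Rightarrow> nat" where
  "innermost q = Max (insert 0 {a\<in>Openers. a \<le> q \<and> q < partner a})"

lemma innermost_in: "innermost q \<in> insert 0 Openers"
proof -
  have "innermost q \<in> insert 0 {a\<in>Openers. a \<le> q \<and> q < partner a}"
    unfolding innermost_def by (intro Max_in) auto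
  then show ?thesis by auto
qed

lemma innermost_le: "innermost q \<le> q"
  unfolding innermost_def by (subst Max_le_iff) auto

lemma innermost_0 [simp]: "innermost 0 = 0" using innermost_le[of 0] by simp

lemma innermost_end: "innermost (2 * k) = 0"
proof -
  have "{a\<in>Openers. a \<le> 2 * k \<and> 2 * k < partner a} = {}"
    using partner(1) by (fastforce simp: Openers_def)
  then show ?thesis unfolding innermost_def by (simp only: Max_singleton)
qed

lemma innermost_opener: "a \<in> Openers \<Longrightarrow> innermost a = a"
  unfolding innermost_def by (rule Max_eqI) (auto simp: Openers_def)

lemma innermost_cyclic_next: "q \<in> Pos \<Longrightarrow> innermost (cyclic_next k q - 1) = innermost q"
  by (auto simp: cyclic_next_def innermost_end)

context
  assumes nc: "noncrossing \<pi>"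
begin

lemma nested: "a \<in> Openers \<Longrightarrow> c \<in> Openers \<Longrightarrow> a < c \<Longrightarrow> c < partner a \<Longrightarrow> partner c < partner a"
proof -
  assume a: "a \<in> Openers" "c \<in> Openers" "a < c" "c < partner a"
  have "{a, partner a} \<in> \<pi>" "{c, partner c} \<in> \<pi>" using a by (auto simp: partner_block Openers_def)
  then have "\<not> partner a < partner c" using nc a unfolding noncrossing_def by blast
  moreover have "partner a \<noteq> partner c" using a partner(2) Openers_subset_Pos by (metis less_irrefl)
  ultimately show ?thesis by simp
qed

lemma innermost_before_partner:
  assumes "a \<in> Openers" shows "innermost (partner a - 1) = a"
  unfolding innermost_def
proof (rule Max_eqI)
  show "a \<in> insert 0 {c\<in>Openers. c \<le> partner a - 1 \<and> partner a - 1 < partner c}"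
    using assms by (auto simp: Openers_def)
  fix c assume c: "c \<in> insert 0 {c\<in>Openers. c \<le> partner a - 1 \<and> partner a - 1 < partner c}"
  show "c \<le> a"
  proof (rule ccontr)
    assume "\<not> c \<le> a"
    then have "c \<in> Openers" "a < c" "c < partner a" "partner a \<le> partner c"
      using c assms by (auto simp: Openers_def)
    then show False using nested[OF assms] by force
  qed
qed auto

lemma innermost_partner:
  assumes a: "a \<in> Openers" shows "innermost (partner a) = innermost (a - 1)"
proof -
  have "c \<le> partner a \<and> partner a < partner c \<longleftrightarrow> c \<le> a - 1 \<and> a - 1 < partner c" if c: "c \<in> Openers" for c
  proof
    assume *: "c \<le> partner a \<and> partner a < partner c"
    have "c \<noteq> partner a" using partner[of a] partner[of c] a c by (auto simp: Openers_def)
    moreover have "\<not> (a < c \<and> c < partner a)" using nested[OF a c] * by auto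
    moreover have "c \<noteq> a" using * by auto
    ultimately show "c \<le> a - 1 \<and> a - 1 < partner c" using * a by (auto simp: Openers_def)
  next
    assume *: "c \<le> a - 1 \<and> a - 1 < partner c"
    have "a > 0" using a by (auto simp: Openers_def)
    have "partner c \<noteq> a" using partner[of c] a c by (auto simp: Openers_def)
    then have "c < a" "a < partner c" using * \<open>a > 0\<close> by auto
    then have "partner a < partner c" using nested[OF c a] by simp
    then show "c \<le> partner a \<and> partner a < partner c" using \<open>c < a\<close> a by (auto simp: Openers_def)
  qed
  then have "{c\<in>Openers. c \<le> partner a \<and> partner a < partner c} = {c\<in>Openers. c \<le> a - 1 \<and> a - 1 < partner c}"
    by blast
  then show ?thesis unfolding innermost_def by simp
qed

text \<open>
  A function of the position that takes equal values before and after every excursion depends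
  only on the vertex of the tree. Such an excursion starts at position \<open>a - 1\<close>, descends to the vertex
  \<open>a\<close>, where it is again at position \<open>partner a - 1\<close>, and goes back along the same edge; this is why
  the hypothesis may be restricted to \<open>a\<close> with \<open>f (partner a - 1) = f a\<close>.
\<close>

lemma eq_at_innermost:
  assumes closed: "\<And>a. a \<in> Openers \<Longrightarrow> f (partner a - 1) = f a \<Longrightarrow> f (partner a) = f (a - 1)"
    and "q \<le> 2 * k"
  shows "f q = f (innermost q)"
  using assms(2)
proof (induction q rule: less_induct)
  case (less q)
  show ?case
  proof (cases "q = 0")
    case False
    then have "q \<in> Pos" using less.prems by simp
    then show ?thesis
    proof (cases rule: opener_cases)
      case 1
      then show ?thesis by (simp add: innermost_opener)
    next
      case (2 a)
      have "f (q - 1) = f (innermost (q - 1))" using less False by simp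
      then have "f (partner a - 1) = f a" using innermost_before_partner 2 by simp
      then have "f q = f (a - 1)" using closed 2 by simp
      also have "\<dots> = f (innermost (a - 1))" using less 2 by simp
      also have "\<dots> = f (innermost q)" using innermost_partner 2 by simp
      finally show ?thesis .
    qed
  qed simp
qed

definition reversed_labelings :: "nat \<Rightarrow> (nat \<Rightarrow> nat) set" where
  "reversed_labelings m = {t \<in> Pos \<rightarrow>\<^sub>E {1..m}. \<forall>a\<in>Openers.
     t a = t (cyclic_next k (partner a)) \<and> t (cyclic_next k a) = t (partner a)}"

text \<open>
  The position \<open>t q\<close> is the value of the tuple after \<open>q - 1\<close> steps. Hence a reversing tuple is the same
  as an arbitrary labelling \<open>z\<close> of the \<open>k + 1\<close> vertices of the tree, read off along the walk.
\<close>

lemma card_reversed_labelings: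
  assumes "k \<ge> 1"
  shows "card (reversed_labelings m) = m ^ (k + 1)"
proof -
  define Z where "Z = insert 0 Openers \<rightarrow>\<^sub>E {1..m}"
  define f where "f z = restrict (\<lambda>q. z (innermost (q - 1))) Pos" for z :: "nat \<Rightarrow> nat"
  have nxt: "cyclic_next k q \<in> Pos" if "q \<in> Pos" for q using that by (auto simp: cyclic_next_def)
  have fo: "f z (a + 1) = z a" if "a \<in> insert 0 Openers" for z a
  proof -
    have "a + 1 \<in> Pos" using that assms partner(1)[of a] by (auto simp: Openers_def)
    moreover have "innermost a = a" using that innermost_opener by auto
    ultimately show ?thesis by (simp add: f_def)
  qed
  have "f ` Z = reversed_labelings m"
  proof (intro equalityI subsetI)
    fix t assume "t \<in> f ` Z"
    then obtain z where z: "z \<in> Z" and t: "t = f z" by blast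
    have "z (innermost (q - 1)) \<in> {1..m}" for q
      using z PiE_mem[of z "insert 0 Openers" "\<lambda>_. {1..m}" "innermost (q - 1)"] innermost_in[of "q - 1"] by (simp add: Z_def)
    then have "t \<in> Pos \<rightarrow>\<^sub>E {1..m}" by (auto simp: t f_def)
    moreover have "t a = t (cyclic_next k (partner a)) \<and> t (cyclic_next k a) = t (partner a)" if a: "a \<in> Openers" for a
    proof -
      have P: "a \<in> Pos" "partner a \<in> Pos" using a partner(1) Openers_subset_Pos by auto
      show ?thesis using P nxt[OF P(1)] nxt[OF P(2)]
        by (simp add: t f_def innermost_cyclic_next innermost_partner[OF a] innermost_before_partner[OF a] innermost_opener[OF a] del: One_nat_def)
    qed
    ultimately show "t \<in> reversed_labelings m" by (simp add: reversed_labelings_def)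
  next
    fix t assume t: "t \<in> reversed_labelings m"
    define z where "z = restrict (\<lambda>a. t (a + 1)) (insert 0 Openers)"
    have "a + 1 \<in> Pos" if "a \<in> insert 0 Openers" for a
      using that assms partner(1)[of a] by (auto simp: Openers_def)
    then have "t (a + 1) \<in> {1..m}" if "a \<in> insert 0 Openers" for a
      using that t unfolding reversed_labelings_def by blast
    then have "z \<in> Z" unfolding Z_def z_def restrict_PiE_iff by blast
    \<comment> \<open>\<open>g q\<close> is the value after \<open>q\<close> steps; after \<open>2 * k\<close> steps the tuple is back at its start.\<close>
    define g where "g q = t (if q = 2 * k then 1 else q + 1)" for q
    have g: "g q = t (cyclic_next k q)" "g (q - 1) = t q" if "q \<in> Pos" for q
      using that by (auto simp: g_def cyclic_next_def)
    have inner: "g q = g (innermost q)" if "q \<le> 2 * k" for q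
    proof (rule eq_at_innermost[OF _ that])
      fix a assume a: "a \<in> Openers"
      then have P: "a \<in> Pos" "partner a \<in> Pos" using partner(1) Openers_subset_Pos by auto
      show "g (partner a) = g (a - 1)"
        unfolding g[OF P(1)] g[OF P(2)] using t a by (simp add: reversed_labelings_def)
    qed
    have "t q = f z q" for q
    proof (cases "q \<in> Pos")
      case True
      have tp: "innermost (q - 1) \<noteq> 2 * k" using innermost_le[of "q - 1"] True by auto
      have "t q = g (innermost (q - 1))" using g(2)[OF True] inner[of "q - 1"] True by auto
      also have "\<dots> = z (innermost (q - 1))" using innermost_in[of "q - 1"] tp by (auto simp: g_def z_def)
      finally show ?thesis using True by (simp add: f_def)
    next
      case False
      then show ?thesis using t by (auto simp: f_def reversed_labelings_def PiE_def extensional_def)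
    qed
    then have "t = f z" by blast
    then show "t \<in> f ` Z" using \<open>z \<in> Z\<close> by blast
  qed
  moreover have "inj_on f Z"
  proof (rule inj_onI)
    fix z z' assume z: "z \<in> Z" "z' \<in> Z" "f z = f z'"
    then have "z a = z' a" if "a \<in> insert 0 Openers" for a using fo[OF that] by metis
    then show "z = z'" using z by (auto simp: Z_def intro: PiE_ext)
  qed
  ultimately have "card (reversed_labelings m) = card Z" by (metis card_image)
  also have "\<dots> = m ^ (k + 1)"
  proof -
    have "0 \<notin> Openers" by (auto simp: Openers_def)
    then show ?thesis by (simp add: Z_def card_funcsetE card_Openers)
  qed
  finally show ?thesis .
qed

text \<open>
  A compatible tuple that does not reverse every block traverses some block twice in the same
  direction, and such tuples are of lower order.
\<close>

lemma r_count_noncrossing: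
  assumes "k \<ge> 1"
  shows "m ^ (k + 1) \<le> r_count m k \<pi>"
    "r_count m k \<pi> \<le> m ^ (k + 1) + k * (4 ^ k * (m * (2 * m + 1) ^ (k - 1)))"
proof -
  have "reversed_labelings m \<subseteq> labelings m"
  proof
    fix t assume t: "t \<in> reversed_labelings m"
    have "t a = t (cyclic_next k (partner a)) \<and> t (cyclic_next k a) = t (partner a)" if "a \<in> Pos" for a
      using that
    proof (cases rule: opener_cases)
      case (2 c)
      then have "partner a = c" using partner(2)[of c] Openers_subset_Pos by auto
      then show ?thesis using t 2 by (auto simp: reversed_labelings_def)
    qed (use t in \<open>auto simp: reversed_labelings_def\<close>)
    then show "t \<in> labelings m" using t by (auto simp: reversed_labelings_def labelings_def)
  qed
  then show "m ^ (k + 1) \<le> r_count m k \<pi>"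
    unfolding r_count_eq card_reversed_labelings[OF assms, symmetric] by (intro card_mono finite_labelings)
  let ?P = "\<lambda>a. {t \<in> labelings m. t a = t (partner a)}"
  have "labelings m \<subseteq> reversed_labelings m \<union> (\<Union>a\<in>Openers. ?P a)"
  proof
    fix t assume t: "t \<in> labelings m"
    show "t \<in> reversed_labelings m \<union> (\<Union>a\<in>Openers. ?P a)"
    proof (cases "\<exists>a\<in>Openers. t a = t (partner a)")
      case False
      then have "t a = t (cyclic_next k (partner a)) \<and> t (cyclic_next k a) = t (partner a)" if "a \<in> Openers" for a
        using labeling_cases[OF t Openers_subset_Pos[OF that]] that by blast
      then show ?thesis using t by (simp add: reversed_labelings_def labelings_def)
    qed (use t in blast)
  qed
  moreover have fr: "finite (reversed_labelings m)"
    using \<open>reversed_labelings m \<subseteq> labelings m\<close> finite_labelings finite_subset by blast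
  ultimately have "r_count m k \<pi> \<le> card (reversed_labelings m \<union> (\<Union>a\<in>Openers. ?P a))"
    unfolding r_count_eq using finite_labelings by (intro card_mono) auto
  also have "\<dots> \<le> card (reversed_labelings m) + card (\<Union>a\<in>Openers. ?P a)" by (rule card_Un_le)
  also have "card (\<Union>a\<in>Openers. ?P a) \<le> (\<Sum>a\<in>Openers. card (?P a))"
    by (rule card_UN_le) simp
  also have "\<dots> \<le> card Openers * (4 ^ k * (m * (2 * m + 1) ^ (k - 1)))"
    using sum_bounded_above[of Openers "\<lambda>a. card (?P a)"] card_labelings_parallel by simp
  finally show "r_count m k \<pi> \<le> m ^ (k + 1) + k * (4 ^ k * (m * (2 * m + 1) ^ (k - 1)))"
    by (simp add: card_reversed_labelings[OF assms] card_Openers)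
qed

end

section \<open>The volume of a noncrossing pairing\<close>

text \<open>
  Blocks are labelled by increasing minimum, so the label of a block is the rank of its opener. As
  \<open>0\<close> has rank \<open>0\<close>, the rank numbers all vertices of the tree, and parents get smaller numbers than
  their children.
\<close>

definition rank :: "nat \<Rightarrow> nat" where
  "rank a = card {c\<in>Openers. c \<le> a}"

lemma block_label_eq: "q \<in> Pos \<Longrightarrow> block_label \<pi> q = rank (opener q)"
proof -
  assume q: "q \<in> Pos"
  have "(THE W. W \<in> \<pi> \<and> q \<in> W) = {q, partner q}"
  proof (rule the_equality)
    show "{q, partner q} \<in> \<pi> \<and> q \<in> {q, partner q}" using partner_block[OF q] by simp
    fix W assume "W \<in> \<pi> \<and> q \<in> W"
    then show "W = {q, partner q}"
      using disjointD[OF blocks(2), of W "{q, partner q}"] partner_block[OF q] by blast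
  qed
  moreover have "Min {q, partner q} = opener q" for q by (simp add: opener_def)
  moreover have "{V\<in>\<pi>. Min V \<le> opener q} = (\<lambda>a. {a, partner a}) ` {c\<in>Openers. c \<le> opener q}"
  proof (intro equalityI subsetI)
    fix V assume V: "V \<in> {V\<in>\<pi>. Min V \<le> opener q}"
    then have "odd_even_pair V" using blocks(3) by blast
    then obtain a b where ab: "V = {a, b}" "a < b" unfolding odd_even_pair_def by blast
    then have "a \<in> Pos" "b = partner a" using V block_iff by auto
    then have "a \<in> Openers" using ab by (simp add: Openers_def)
    moreover have "Min V = a" using ab by simp
    ultimately show "V \<in> (\<lambda>a. {a, partner a}) ` {c\<in>Openers. c \<le> opener q}"
      using V ab \<open>b = partner a\<close> by auto
  next
    fix V assume "V \<in> (\<lambda>a. {a, partner a}) ` {c\<in>Openers. c \<le> opener q}"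
    then obtain a where a: "a \<in> Openers" "a \<le> opener q" "V = {a, partner a}" by blast
    then have "Min V = a" by (simp add: Openers_def)
    then show "V \<in> {V\<in>\<pi>. Min V \<le> opener q}"
      using a partner_block Openers_subset_Pos by simp
  qed
  moreover have "inj_on (\<lambda>a. {a, partner a}) {c\<in>Openers. c \<le> opener q}"
    by (rule inj_onI) (auto simp: doubleton_eq_iff Openers_def)
  ultimately show ?thesis
    by (simp add: block_label_def rank_def card_image)
qed

lemma rank_mono:
  assumes "a < b" "b \<in> Openers" shows "rank a < rank b"
proof -
  have "b \<in> {c\<in>Openers. c \<le> b} - {c\<in>Openers. c \<le> a}" using assms by auto
  moreover have "{c\<in>Openers. c \<le> a} \<subseteq> {c\<in>Openers. c \<le> b}" using assms by auto
  ultimately have "{c\<in>Openers. c \<le> a} \<subset> {c\<in>Openers. c \<le> b}" by blast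
  then show ?thesis unfolding rank_def by (rule psubset_card_mono[rotated]) simp
qed

lemma rank_bij: "bij_betw rank (insert 0 Openers) {0..k}"
proof -
  have inj: "inj_on rank (insert 0 Openers)"
  proof (rule inj_onI)
    fix a b assume "a \<in> insert 0 Openers" "b \<in> insert 0 Openers" "rank a = rank b"
    then show "a = b"
      using rank_mono[of a b] rank_mono[of b a] by (cases a b rule: linorder_cases) auto
  qed
  have le: "rank a \<le> k" for a
    using card_mono[of Openers "{c\<in>Openers. c \<le> a}"] by (simp add: rank_def card_Openers)
  have "0 \<notin> Openers" by (simp add: Openers_def)
  then have "card (insert 0 Openers) = k + 1" by (simp add: card_Openers)
  then have "card (rank ` insert 0 Openers) = card {0..k}" using card_image[OF inj] by simp
  then have "rank ` insert 0 Openers = {0..k}"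
    by (intro card_subset_eq) (use le in auto)
  then show ?thesis using inj by (simp add: bij_betw_def)
qed

lemma rank_0: "rank 0 = 0" by (auto simp: rank_def Openers_def)

definition walk :: "(nat \<Rightarrow> real) \<Rightarrow> nat \<Rightarrow> real" where
  "walk x j = x 0 - (\<Sum>q=1..j. (-1) ^ q * x (block_label \<pi> q))"

lemma walk_step: "q \<in> Pos \<Longrightarrow> walk x q = walk x (q - 1) - (-1) ^ q * x (rank (opener q))"
  by (cases q) (auto simp: walk_def block_label_eq[symmetric])

text \<open>
  The two elements of a block have opposite parity, so the alternating signs make the walk undo at
  \<open>partner a\<close> the step it made at \<open>a\<close>.
\<close>

lemma walk_innermost:
  assumes nc: "noncrossing \<pi>" and "q \<le> 2 * k"
  shows "walk x q = walk x (innermost q)"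
proof (rule eq_at_innermost[OF nc _ assms(2)])
  fix a assume a: "a \<in> Openers" and eq: "walk x (partner a - 1) = walk x a"
  have P: "a \<in> Pos" "partner a \<in> Pos" using a partner(1) Openers_subset_Pos by auto
  have "(-1 :: real) ^ partner a = - ((-1) ^ a)"
    using partner(3)[OF P(1)] by (cases "even a") auto
  then show "walk x (partner a) = walk x (a - 1)"
    using walk_step[OF P(1), of x] walk_step[OF P(2), of x] eq a by (simp add: opener_Openers)
qed

text \<open>
  Every value of the walk is its value at a vertex of the tree, so the integrand is the indicator
  function of the event that all vertex values lie in \<open>[0, 1]\<close>. The bounds on the variables
  are then automatic: the variable of a block is, up to sign, the difference of two vertex values.
\<close>

lemma hankel_volume_noncrossing:
  assumes nc: "noncrossing \<pi>"
  shows "hankel_volume k \<pi> = 1"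
proof -
  \<comment> \<open>\<open>\<rho> i\<close> is the vertex with number \<open>i\<close>, \<open>z x i\<close> its value and \<open>p i\<close> the number of its parent.\<close>
  define \<rho> where "\<rho> = the_inv_into (insert 0 Openers) rank"
  define z where "z x i = walk x (\<rho> i)" for x i
  define p where "p i = rank (innermost (\<rho> i - 1))" for i
  define s where "s i = - ((-1 :: real) ^ \<rho> i)" for i
  have \<rho>_rank: "\<rho> (rank a) = a" if "a \<in> insert 0 Openers" for a
    unfolding \<rho>_def using rank_bij that by (intro the_inv_into_f_f) (auto simp: bij_betw_def)
  have rank_\<rho>: "rank (\<rho> i) = i" "\<rho> i \<in> insert 0 Openers" if "i \<le> k" for i
  proof -
    have "i \<in> rank ` insert 0 Openers" using rank_bij that by (auto simp: bij_betw_def)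
    then show "rank (\<rho> i) = i" "\<rho> i \<in> insert 0 Openers" using \<rho>_rank by auto
  qed
  have \<rho>0: "\<rho> 0 = 0" using \<rho>_rank[of 0] by (simp add: rank_0)
  have \<rho>O: "\<rho> i \<in> Openers" if "i \<in> {1..k}" for i
    using rank_\<rho>[of i] that rank_0 by (cases "\<rho> i = 0") auto
  have z0: "z x 0 = x 0" for x by (simp add: z_def \<rho>0 walk_def)
  have zS: "z x i = z x (p i) + s i * x i" if i: "i \<in> {1..k}" for x i
  proof -
    have P: "\<rho> i \<in> Pos" using \<rho>O[OF i] by (rule Openers_subset_Pos)
    have "z x i = walk x (\<rho> i - 1) - (-1) ^ \<rho> i * x (rank (opener (\<rho> i)))"
      unfolding z_def by (rule walk_step[OF P])
    also have "walk x (\<rho> i - 1) = walk x (innermost (\<rho> i - 1))"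
      by (rule walk_innermost[OF nc]) (use P in auto)
    also have "\<dots> = z x (p i)"
      unfolding z_def p_def using \<rho>_rank[OF innermost_in] by simp
    also have "rank (opener (\<rho> i)) = i" using opener_Openers(1)[OF \<rho>O[OF i]] rank_\<rho>(1)[of i] i by simp
    finally show ?thesis by (simp add: s_def)
  qed
  have p_less: "p i < i" if i: "i \<in> {1..k}" for i
  proof -
    have "\<rho> i > 0" using \<rho>O[OF i] by (auto simp: Openers_def)
    then have "innermost (\<rho> i - 1) < \<rho> i" using innermost_le[of "\<rho> i - 1"] by linarith
    then have "rank (innermost (\<rho> i - 1)) < rank (\<rho> i)" using \<rho>O[OF i] by (rule rank_mono)
    then show ?thesis using rank_\<rho>(1)[of i] i by (simp add: p_def)
  qed
  have s: "s i = 1 \<or> s i = -1" for i by (cases "even (\<rho> i)") (auto simp: s_def)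
  let ?M = "\<Pi>\<^sub>M l\<in>{0..k}. lborel :: real measure"
  let ?A = "\<Pi>\<^sub>E l\<in>{0..k}. if l = 0 then {0..1} else {-1..1::real}"
  let ?h = "\<lambda>x. \<Prod>i\<le>k. indicat_real {0..1} (z x i)"
  have eq: "indicat_real ?A x *\<^sub>R (\<Prod>j=1..2*k. indicat_real {0..1} (walk x j)) = ?h x" if x: "x \<in> space ?M" for x
  proof -
    have ind: "(\<Prod>i\<in>I. indicat_real {0..1} (f i)) = (if \<forall>i\<in>I. f i \<in> {0..1} then 1 else 0)" if "finite I" for I and f :: "nat \<Rightarrow> real"
      using that by (induction I rule: finite_induct) (auto simp: indicator_def)
    have "x \<in> ?A \<and> (\<forall>j\<in>{1..2*k}. walk x j \<in> {0..1}) \<longleftrightarrow> (\<forall>i\<in>{..k}. z x i \<in> {0..1})"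
    proof
      assume L: "x \<in> ?A \<and> (\<forall>j\<in>{1..2*k}. walk x j \<in> {0..1})"
      show "\<forall>i\<in>{..k}. z x i \<in> {0..1}"
      proof
        fix i assume i: "i \<in> {..k}"
        show "z x i \<in> {0..1}"
        proof (cases "i = 0")
          case True
          have "x \<in> ?A" using L by blast
          from PiE_mem[OF this, of 0] have "x 0 \<in> {0..1}" by simp
          then show ?thesis using True by (simp add: z0)
        next
          case False
          then have "\<rho> i \<in> Pos" using i by (intro Openers_subset_Pos \<rho>O) simp
          then show ?thesis using L unfolding z_def by blast
        qed
      qed
    next
      assume R: "\<forall>i\<in>{..k}. z x i \<in> {0..1}"
      have "walk x j \<in> {0..1}" if "j \<in> {1..2*k}" for j
      proof -
        have "walk x j = z x (rank (innermost j))"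
          using walk_innermost[OF nc, of j x] that \<rho>_rank[OF innermost_in] by (simp add: z_def)
        moreover have "rank (innermost j) \<le> k" using innermost_in[of j] rank_bij by (auto simp: bij_betw_def)
        ultimately show ?thesis using R by simp
      qed
      moreover have "x \<in> ?A"
      proof (rule PiE_I)
        fix l assume l: "l \<in> {0..k}"
        show "x l \<in> (if l = 0 then {0..1} else {-1..1})"
        proof (cases "l = 0")
          case True
          have "z x 0 \<in> {0..1}" using R by simp
          then show ?thesis using True by (simp add: z0)
        next
          case False
          then have l1: "l \<in> {1..k}" using l by simp
          then have "z x l \<in> {0..1}" "z x (p l) \<in> {0..1}" using R p_less[OF l1] by auto
          then show ?thesis using zS[OF l1, of x] s[of l] False by auto
        qed
      next
        fix l assume "l \<notin> {0..k}"
        then show "x l = undefined" using x by (auto simp: space_PiM PiE_def extensional_def)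
      qed
      ultimately show "x \<in> ?A \<and> (\<forall>j\<in>{1..2*k}. walk x j \<in> {0..1})" by blast
    qed
    then show ?thesis
      unfolding ind[OF finite_atMost] ind[OF finite_atLeastAtMost] by (cases "x \<in> ?A") auto
  qed
  have "hankel_volume k \<pi> = integral\<^sup>L ?M (\<lambda>x. indicat_real ?A x *\<^sub>R (\<Prod>j=1..2*k. indicat_real {0..1} (walk x j)))"
    by (simp add: hankel_volume_def set_lebesgue_integral_def walk_def)
  also have "\<dots> = integral\<^sup>L ?M ?h"
    by (rule Bochner_Integration.integral_cong[OF refl eq])
  also have "\<dots> = 1"
  proof -
    have e: "ennreal (?h x) = (\<Prod>i\<le>k. indicator {0..1} (z x i))" for x
      by (simp add: prod_ennreal[symmetric] ennreal_indicator)
    have tree: "(\<lambda>x. \<Prod>i\<le>k. indicator {0..1} (z x i) :: ennreal) \<in> borel_measurable ?M"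
      "(\<integral>\<^sup>+x. (\<Prod>i\<le>k. indicator {0..1} (z x i)) \<partial>?M) = 1"
      by (rule nn_integral_tree_indicator[of z k p s]; (rule z0 zS p_less s, assumption?))+
    have "?h = (\<lambda>x. enn2real (\<Prod>i\<le>k. indicator {0..1} (z x i)))"
      unfolding e[symmetric] by (simp add: prod_nonneg)
    moreover have "(\<lambda>x. enn2real (\<Prod>i\<le>k. indicator {0..1} (z x i))) \<in> borel_measurable ?M"
      using tree(1) by measurable
    ultimately have "?h \<in> borel_measurable ?M" by simp
    then have "integral\<^sup>L ?M ?h = enn2real (\<integral>\<^sup>+x. ennreal (?h x) \<partial>?M)"
      by (intro integral_eq_nn_integral) (auto intro!: prod_nonneg)
    then show ?thesis unfolding e tree(2) by simp
  qed
  finally show ?thesis .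
qed

end
section \<open>Convergence of the moments\<close>

lemma semicircle_moment_even: "semicircle_moment (2 * n) = catalan n"
proof (induction n)
  case 0
  show ?case by (simp add: semicircle_moment_0)
next
  case (Suc n)
  have "(real n + 2) * semicircle_moment (2 * Suc n) = (4 * real n + 2) * semicircle_moment (2 * n)"
    using semicircle_moment_Suc_Suc[of "2 * n"] by (simp add: algebra_simps)
  also have "\<dots> = (real n + 2) * catalan (Suc n)"
    using catalan_linear_rec[of n] Suc by simp
  finally show ?case by simp
qed

lemma catalan_le: "real (catalan n) \<le> 4 ^ n"
proof (induction n)
  case (Suc n)
  have "(real n + 2) * catalan (Suc n) = (4 * real n + 2) * catalan n" by (rule catalan_linear_rec)
  also have "\<dots> \<le> ((real n + 2) * 4) * 4 ^ n"
    using Suc by (intro mult_mono) auto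
  finally have "(real n + 2) * catalan (Suc n) \<le> (real n + 2) * 4 ^ Suc n"
    by (simp only: mult.assoc power_Suc)
  then show ?case by (rule mult_left_le_imp_le) simp
qed simp

lemma noncrossing_odd_even_pairings:
  "{\<pi> \<in> odd_even_pairings k. noncrossing \<pi>} = nc_pairings {1..<1 + 2 * k}"
proof -
  have "{1..<1 + 2 * k} = {1..2 * k}" by auto
  then show ?thesis
    unfolding odd_even_pairings_def nc_pairings_def odd_even_pair_iff[symmetric] by auto
qed

lemma lower_order_count:
  assumes "m \<ge> 1" "k \<ge> 1"
  shows "real (m * (2 * m + 1) ^ (k - 1)) / real m ^ (k + 1) \<le> 3 ^ (k - 1) / real m"
proof -
  obtain j where k: "k = Suc j" using assms(2) by (cases k) auto
  have "real (m * (2 * m + 1) ^ j) = real m * real (2 * m + 1) ^ j"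
    by (simp only: of_nat_mult of_nat_power)
  also have "\<dots> \<le> real m * (3 * real m) ^ j"
    using assms(1) by (intro mult_left_mono power_mono) auto
  also have "\<dots> = 3 ^ j / real m * real m ^ (k + 1)"
    using assms(1) by (simp add: k power_mult_distrib)
  finally show ?thesis using assms(1) by (simp add: k divide_le_eq)
qed

text \<open>
  With \<open>c = 1\<close> this handles noncrossing pairings and with \<open>c = 0\<close> crossing ones.
\<close>

lemma tendsto_leading_coefficient:
  fixes a :: "nat \<Rightarrow> nat"
  assumes k: "k \<ge> 1" and low: "\<And>m. c * m ^ (k + 1) \<le> a m"
    and up: "\<And>m. a m \<le> c * m ^ (k + 1) + C * (m * (2 * m + 1) ^ (k - 1))"
  shows "(\<lambda>m. real (a m) / real m ^ (k + 1)) \<longlonglongrightarrow> real c"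
proof (rule tendsto_sandwich[where f = "\<lambda>_. real c"])
  have "(\<lambda>m. real c + real C * (3 ^ (k - 1) * inverse (real m))) \<longlonglongrightarrow> real c + real C * (3 ^ (k - 1) * 0)"
    by (intro tendsto_intros lim_inverse_n)
  then show "(\<lambda>m. real c + real C * (3 ^ (k - 1) / real m)) \<longlonglongrightarrow> real c" by (simp add: divide_inverse)
  show "\<forall>\<^sub>F m in sequentially. real c \<le> real (a m) / real m ^ (k + 1)"
  proof (rule eventually_sequentiallyI[of 1])
    fix m :: nat assume m: "1 \<le> m"
    have "real (c * m ^ (k + 1)) \<le> real (a m)" using low of_nat_le_iff by blast
    then show "real c \<le> real (a m) / real m ^ (k + 1)"
      using m by (simp add: le_divide_eq)
  qed
  show "\<forall>\<^sub>F m in sequentially. real (a m) / real m ^ (k + 1) \<le> real c + real C * (3 ^ (k - 1) / real m)"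
  proof (rule eventually_sequentiallyI[of 1])
    fix m :: nat assume m: "1 \<le> m"
    have "real (a m) \<le> real (c * m ^ (k + 1) + C * (m * (2 * m + 1) ^ (k - 1)))"
      using up of_nat_le_iff by blast
    then have "real (a m) / real m ^ (k + 1)
        \<le> real (c * m ^ (k + 1) + C * (m * (2 * m + 1) ^ (k - 1))) / real m ^ (k + 1)"
      by (rule divide_right_mono) simp
    also have "\<dots> = real c + real C * (real (m * (2 * m + 1) ^ (k - 1)) / real m ^ (k + 1))"
      using m by (simp add: add_divide_distrib)
    also have "\<dots> \<le> real c + real C * (3 ^ (k - 1) / real m)"
      by (intro add_left_mono mult_left_mono lower_order_count m k) simp
    finally show "real (a m) / real m ^ (k + 1) \<le> real c + real C * (3 ^ (k - 1) / real m)" .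
  qed
qed simp

lemma block_hankel_moment_tendsto:
  assumes k: "k \<ge> 1"
  shows "(\<lambda>m. block_hankel_moment m k) \<longlonglongrightarrow> catalan k"
proof -
  have lim: "(\<lambda>m. real (r_count m k \<pi>) / real m ^ (k + 1) * hankel_volume k \<pi>)
      \<longlonglongrightarrow> (if noncrossing \<pi> then 1 else 0)" if \<pi>: "\<pi> \<in> odd_even_pairings k" for \<pi>
  proof -
    interpret odd_even_pairing k \<pi> by standard (rule \<pi>)
    show ?thesis
    proof (cases "noncrossing \<pi>")
      case True
      have "(\<lambda>m. real (r_count m k \<pi>) / real m ^ (k + 1)) \<longlonglongrightarrow> real 1"
        by (rule tendsto_leading_coefficient[OF k, where C = "k * 4 ^ k"])
          (use r_count_noncrossing[OF True k] in \<open>simp_all add: mult.assoc\<close>)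
      then show ?thesis using True hankel_volume_noncrossing by simp
    next
      case False
      have "(\<lambda>m. real (r_count m k \<pi>) / real m ^ (k + 1)) \<longlonglongrightarrow> real 0"
        by (rule tendsto_leading_coefficient[OF k, where C = "2 * 4 ^ k"])
          (use r_count_crossing[OF False] in \<open>simp_all add: mult.assoc\<close>)
      then have "(\<lambda>m. real (r_count m k \<pi>) / real m ^ (k + 1) * hankel_volume k \<pi>) \<longlonglongrightarrow> 0 * hankel_volume k \<pi>"
        by (intro tendsto_intros) simp
      then show ?thesis using False by simp
    qed
  qed
  have fin: "finite (odd_even_pairings k)"
    unfolding odd_even_pairings_def
    by (rule finite_subset[OF _ finitely_many_partition_on[of "{1..2*k}"]]) auto
  have "(\<lambda>m. block_hankel_moment m k) \<longlonglongrightarrow> (\<Sum>\<pi>\<in>odd_even_pairings k. if noncrossing \<pi> then 1 else 0)"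
    unfolding block_hankel_moment_def by (intro tendsto_sum lim)
  also have "(\<Sum>\<pi>\<in>odd_even_pairings k. if noncrossing \<pi> then 1 else 0) = real (card {\<pi> \<in> odd_even_pairings k. noncrossing \<pi>})"
    using fin by (simp add: sum.If_cases Int_def)
  also have "\<dots> = real (catalan k)"
    unfolding noncrossing_odd_even_pairings card_nc_pairings ..
  finally show ?thesis .
qed

theorem mainTheorem5:
  fixes \<gamma>\<^sub>H :: "nat \<Rightarrow> real measure"
  assumes "\<And>m. m \<ge> 1 \<Longrightarrow> is_gamma_H m (\<gamma>\<^sub>H m)"
  shows "weak_conv_m \<gamma>\<^sub>H semicircle_law"
proof -
  \<comment> \<open>Nothing is known about the measure with index \<open>0\<close>, so the sequence is shifted by one.\<close>
  have G: "is_gamma_H (Suc n) (\<gamma>\<^sub>H (Suc n))" for n by (rule assms) simp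
  then have dist: "real_distribution (\<gamma>\<^sub>H (Suc n))"
    and int: "integrable (\<gamma>\<^sub>H (Suc n)) (\<lambda>x. x ^ j)" for n j
    unfolding is_gamma_H_def by blast+
  have conv: "(\<lambda>n. LINT x|\<gamma>\<^sub>H (Suc n). x ^ j) \<longlonglongrightarrow> (LINT x|semicircle_law. x ^ j)" for j
    unfolding semicircle_moment_def[symmetric]
  proof (cases "odd j")
    case True
    then have "(LINT x|\<gamma>\<^sub>H (Suc n). x ^ j) = 0" for n using G unfolding is_gamma_H_def by blast
    then show "(\<lambda>n. LINT x|\<gamma>\<^sub>H (Suc n). x ^ j) \<longlonglongrightarrow> semicircle_moment j"
      using semicircle_moment_odd[OF True] by simp
  next
    case False
    then obtain k where j: "j = 2 * k" by (auto elim: evenE)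
    show "(\<lambda>n. LINT x|\<gamma>\<^sub>H (Suc n). x ^ j) \<longlonglongrightarrow> semicircle_moment j"
    proof (cases "k = 0")
      case True
      have "(LINT x|\<gamma>\<^sub>H (Suc n). x ^ j) = 1" for n
      proof -
        interpret real_distribution "\<gamma>\<^sub>H (Suc n)" by (rule dist)
        show ?thesis using True j prob_space by simp
      qed
      then show ?thesis using True j by (simp add: semicircle_moment_0)
    next
      case False
      then have "(LINT x|\<gamma>\<^sub>H (Suc n). x ^ j) = block_hankel_moment (Suc n) k" for n
        using G j unfolding is_gamma_H_def by simp
      moreover have "(\<lambda>n. block_hankel_moment (Suc n) k) \<longlonglongrightarrow> catalan k"
        using block_hankel_moment_tendsto[of k] False by (intro LIMSEQ_Suc) simp
      ultimately show ?thesis by (simp add: j semicircle_moment_even)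
    qed
  qed
  have "(LINT x|semicircle_law. x ^ (2 * j)) \<le> 2 ^ (2 * j)" for j
  proof -
    have "(LINT x|semicircle_law. x ^ (2 * j)) = catalan j"
      using semicircle_moment_even[of j] by (simp only: semicircle_moment_def)
    then show ?thesis using catalan_le[of j] by (simp add: power_mult[of "2 :: real"])
  qed
  then have "weak_conv_m (\<lambda>n. \<gamma>\<^sub>H (Suc n)) semicircle_law"
    by (intro weak_conv_m_of_moments[where R = 2] dist int conv real_distribution_semicircle semicircle_moment_integral(1))
  then show ?thesis
    unfolding weak_conv_m_def weak_conv_def by (auto intro: LIMSEQ_imp_Suc)
qed

end
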